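(* Let $\Gamma_0$ be a Lie subgroup of positive dimension of $GL(n,\mathbb R)$ with Lie algebra $\mathfrak m$, $\delta:\Gamma_0\to\Gamma_0$ an endomorphism, and $A,B\in GL(n,\mathbb R)$ such that no matrix $M^{-1}B^{-1}M^{\delta}A$, $M\in\Gamma_0$, has eigenvalue $1$, and suppose that the loop $L_\Xi=L_{A,B,\Gamma_0,\delta}$ (see context) is smooth. Then the Akivis algebra $\mathfrak a_{L_\Xi}$ of $L_\Xi$ is a semidirect product $\mathbb R^n\rtimes\mathfrak m$ of the commutative Lie algebra $\mathbb R^n$ by the Lie algebra $\mathfrak m$ of the group $\Gamma_0$.
   Context: The loop $L_\Xi=L_{A,B,\Gamma_0,\delta}$ is realized on $\mathbb R^n\times\Gamma_0$ with multiplication $$(u_1,M_1)\ast(u_2,M_2)=\Big(u_1+[B-(M_1M_2)^{\delta}A(M_1M_2)^{-1}]^{-1}M_1^{\delta}(B-M_2^{\delta}AM_2^{-1})u_2,\ M_1M_2\Big)$$ and identity $(0,I)$. In a loop, $b/a$ denotes the unique $x$ with $x\ast a=b$. A loop is smooth if it is a $\mathcal C^\infty$-manifold and its multiplication and both divisions are differentiable. An Akivis algebra $(\mathfrak a,[.,.],\langle.,.,.\rangle)$ is a real vector space with a bilinear skew-symmetric map $[.,.]$ and a trilinear map $\langle.,.,.\rangle$ satisfying $$[[x,y],z]+[[z,x],y]+[[y,z],x]=\langle x,y,z\rangle+\langle y,z,x\rangle+\langle z,x,y\rangle-\langle z,y,x\rangle-\langle x,z,y\rangle-\langle y,x,z\rangle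 .$$ A homomorphism of Akivis algebras is a linear map respecting both operations. The Akivis algebra $\mathfrak a_{L_\Xi}$ is realized on the tangent space $\mathbb R^n\oplus\mathfrak m$ at the identity. Put $X_i(t)=(tx_i,\exp tm_i)$ for $x_i\in\mathbb R^n$, $m_i\in\mathfrak m$; then $$[(x_1,m_1),(x_2,m_2)]=\lim_{t\to0}\tfrac1{t^2}\big((X_1\ast X_2)/(X_2\ast X_1)\big),$$ $$\langle(x_1,m_1),(x_2,m_2),(x_3,m_3)\rangle=\lim_{t\to0}\tfrac1{t^3}\big(((X_1\ast X_2)\ast X_3)/(X_1\ast(X_2\ast X_3))\big),$$ where elements near the identity are expressed in the coordinates $(x,\exp m)\leftrightarrow(x,m)$. An Akivis algebra $\mathfrak a$ is a semidirect product $N\rtimes M$ of a Lie algebra $N$ by a Lie algebra $M$ if there exist in $\mathfrak a$ Lie subalgebras $N$ and $M$ together with an endomorphism (homomorphism of Akivis algebras) $\alpha:\mathfrak a\to M$ such that $N$ is the kernel of $\alpha$ and $\mathfrak a=N\oplus M$ as vector spaces. *)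

theory Defs
  imports "HOL-Analysis.Analysis" "HOL-Algebra.Group"
begin

section \<open>Smooth manifolds\<close>

text \<open>Both notions below are only meant for open sets \<open>S\<close>.\<close>

primrec ck_on :: "nat \<Rightarrow> 'a::euclidean_space set \<Rightarrow> ('a \<Rightarrow> 'b::euclidean_space) \<Rightarrow> bool" where
  "ck_on 0 S f \<longleftrightarrow> continuous_on S f"
| "ck_on (Suc k) S f \<longleftrightarrow>
     (\<forall>x\<in>S. f differentiable (at x)) \<and> (\<forall>v. ck_on k S (\<lambda>x. frechet_derivative f (at x) v))"

definition smooth_on :: "'a::euclidean_space set \<Rightarrow> ('a \<Rightarrow> 'b::euclidean_space) \<Rightarrow> bool" where
  "smooth_on S f \<longleftrightarrow> (\<forall>k. ck_on k S f)"

text \<open>A chart is a pair \<open>(U, \<phi>)\<close>; only the values of \<open>\<phi>\<close> on \<open>U\<close> matter.\<close>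

type_synonym ('a, 'k) atlas = "('a set \<times> ('a \<Rightarrow> 'k)) set"

definition second_countable :: "'a topology \<Rightarrow> bool" where
  "second_countable T \<longleftrightarrow>
     (\<exists>\<B>. countable \<B> \<and> (\<forall>V\<in>\<B>. openin T V) \<and>
        (\<forall>U x. openin T U \<and> x \<in> U \<longrightarrow> (\<exists>V\<in>\<B>. x \<in> V \<and> V \<subseteq> U)))"

definition smooth_manifold :: "'a topology \<Rightarrow> ('a, 'k::euclidean_space) atlas \<Rightarrow> bool" where
  "smooth_manifold T \<A> \<longleftrightarrow>
     Hausdorff_space T \<and> second_countable T \<and> topspace T = (\<Union>(U, \<phi>)\<in>\<A>. U) \<and>
     (\<forall>(U, \<phi>)\<in>\<A>. openin T U \<and> open (\<phi> ` U) \<and>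
        homeomorphic_map (subtopology T U) (top_of_set (\<phi> ` U)) \<phi>) \<and>
     (\<forall>(U, \<phi>)\<in>\<A>. \<forall>(V, \<psi>)\<in>\<A>. smooth_on (\<phi> ` (U \<inter> V)) (\<psi> \<circ> inv_into U \<phi>))"

definition euclidean_atlas :: "('a::euclidean_space, 'a) atlas" where
  "euclidean_atlas = {(UNIV, id)}"

definition prod_atlas :: "('a, 'k) atlas \<Rightarrow> ('b, 'l) atlas \<Rightarrow> ('a \<times> 'b, 'k \<times> 'l) atlas" where
  "prod_atlas \<A> \<B> = {(U \<times> V, map_prod \<phi> \<psi>) |U \<phi> V \<psi>. (U, \<phi>) \<in> \<A> \<and> (V, \<psi>) \<in> \<B>}"

definition smooth_map ::
  "'a topology \<Rightarrow> ('a, 'k::euclidean_space) atlas \<Rightarrow>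
   'b topology \<Rightarrow> ('b, 'l::euclidean_space) atlas \<Rightarrow> ('a \<Rightarrow> 'b) \<Rightarrow> bool" where
  "smooth_map S \<A> T \<B> f \<longleftrightarrow> continuous_map S T f \<and>
     (\<forall>(U, \<phi>)\<in>\<A>. \<forall>(V, \<psi>)\<in>\<B>. smooth_on (\<phi> ` {p \<in> U. f p \<in> V}) (\<psi> \<circ> f \<circ> inv_into U \<phi>))"

definition differentiable_map ::
  "'a topology \<Rightarrow> ('a, 'k::euclidean_space) atlas \<Rightarrow>
   'b topology \<Rightarrow> ('b, 'l::euclidean_space) atlas \<Rightarrow> ('a \<Rightarrow> 'b) \<Rightarrow> bool" where
  "differentiable_map S \<A> T \<B> f \<longleftrightarrow> continuous_map S T f \<and>
     (\<forall>(U, \<phi>)\<in>\<A>. \<forall>(V, \<psi>)\<in>\<B>. (\<psi> \<circ> f \<circ> inv_into U \<phi>) differentiable_on (\<phi> ` {p \<in> U. f p \<in> V}))"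

section \<open>Lie subgroups of the general linear group\<close>

definition GL :: "(real^'n^'n) monoid" where
  "GL = \<lparr>carrier = {M. invertible M}, monoid.mult = (**), one = mat 1\<rparr>"

definition mat_eigenvalue :: "real^'n^'n \<Rightarrow> real \<Rightarrow> bool" where
  "mat_eigenvalue M c \<longleftrightarrow> (\<exists>v. v \<noteq> 0 \<and> M *v v = c *\<^sub>R v)"

text \<open>The ring operation \<open>*\<close> on \<open>real^'n^'n\<close> is componentwise, so the powers are
  iterates of \<open>**\<close>.\<close>

definition mat_exp :: "real^'n^'n \<Rightarrow> real^'n^'n" where
  "mat_exp X = (\<Sum>k. (1 / fact k) *\<^sub>R (((**) X ^^ k) (mat 1)))"

text \<open>Lie subgroups are immersed: the manifold topology \<open>T\<close> of \<open>\<Gamma>\<close> may be finer than the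
  topology induced from the matrices. The dimension of \<open>\<Gamma>\<close> is \<open>DIM('k)\<close>, which is positive
  for every \<open>'k::euclidean_space\<close>.\<close>

definition lie_subgroup ::
  "(real^'n^'n) set \<Rightarrow> (real^'n^'n) topology \<Rightarrow> (real^'n^'n, 'k::euclidean_space) atlas \<Rightarrow> bool" where
  "lie_subgroup \<Gamma> T \<A> \<longleftrightarrow>
     subgroup \<Gamma> GL \<and> topspace T = \<Gamma> \<and> smooth_manifold T \<A> \<and>
     smooth_map (prod_topology T T) (prod_atlas \<A> \<A>) T \<A> (\<lambda>(M, N). M ** N) \<and>
     smooth_map T \<A> T \<A> matrix_inv \<and>
     smooth_map T \<A> euclidean euclidean_atlas (\<lambda>M. M) \<and>
     (\<forall>(U, \<phi>)\<in>\<A>. \<forall>x\<in>\<phi> ` U. inj (frechet_derivative (inv_into U \<phi>) (at x)))"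

text \<open>The image in \<open>gl(n, \<real>)\<close> of the tangent space at the identity under the differential
  of the inclusion.\<close>

definition lie_algebra_of :: "(real^'n^'n, 'k::euclidean_space) atlas \<Rightarrow> (real^'n^'n) set" where
  "lie_algebra_of \<A> =
     (\<Union>(U, \<phi>)\<in>{(U, \<phi>)\<in>\<A>. mat 1 \<in> U}.
        range (frechet_derivative (inv_into U \<phi>) (at (\<phi> (mat 1)))))"

definition commutator :: "real^'n^'n \<Rightarrow> real^'n^'n \<Rightarrow> real^'n^'n" where
  "commutator X Y = X ** Y - Y ** X"

section \<open>Loops\<close>

definition loop_on :: "'a set \<Rightarrow> ('a \<Rightarrow> 'a \<Rightarrow> 'a) \<Rightarrow> 'a \<Rightarrow> bool" where
  "loop_on L f e \<longleftrightarrow>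
     (\<forall>a\<in>L. \<forall>b\<in>L. f a b \<in> L) \<and> e \<in> L \<and> (\<forall>a\<in>L. f e a = a \<and> f a e = a) \<and>
     (\<forall>a\<in>L. \<forall>b\<in>L. (\<exists>!x. x \<in> L \<and> f x a = b) \<and> (\<exists>!y. y \<in> L \<and> f a y = b))"

definition right_div :: "'a set \<Rightarrow> ('a \<Rightarrow> 'a \<Rightarrow> 'a) \<Rightarrow> 'a \<Rightarrow> 'a \<Rightarrow> 'a" where
  "right_div L f b a = (THE x. x \<in> L \<and> f x a = b)"

definition left_div :: "'a set \<Rightarrow> ('a \<Rightarrow> 'a \<Rightarrow> 'a) \<Rightarrow> 'a \<Rightarrow> 'a \<Rightarrow> 'a" where
  "left_div L f a b = (THE y. y \<in> L \<and> f a y = b)"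

text \<open>The operations of a smooth loop are required to be differentiable, which a priori is
  weaker than being \<open>C\<^sup>\<infinity>\<close>.\<close>

definition smooth_loop ::
  "'a topology \<Rightarrow> ('a, 'k::euclidean_space) atlas \<Rightarrow> ('a \<Rightarrow> 'a \<Rightarrow> 'a) \<Rightarrow> 'a \<Rightarrow> bool" where
  "smooth_loop T \<A> f e \<longleftrightarrow>
     loop_on (topspace T) f e \<and> smooth_manifold T \<A> \<and>
     differentiable_map (prod_topology T T) (prod_atlas \<A> \<A>) T \<A> (\<lambda>(a, b). f a b) \<and>
     differentiable_map (prod_topology T T) (prod_atlas \<A> \<A>) T \<A>
       (\<lambda>(b, a). right_div (topspace T) f b a) \<and>
     differentiable_map (prod_topology T T) (prod_atlas \<A> \<A>) T \<A>
       (\<lambda>(a, b). left_div (topspace T) f a b)"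

definition xi_mult ::
  "real^'n^'n \<Rightarrow> real^'n^'n \<Rightarrow> (real^'n^'n \<Rightarrow> real^'n^'n) \<Rightarrow>
   (real^'n) \<times> (real^'n^'n) \<Rightarrow> (real^'n) \<times> (real^'n^'n) \<Rightarrow> (real^'n) \<times> (real^'n^'n)" where
  "xi_mult A B \<delta> = (\<lambda>(u1, M1) (u2, M2).
     (u1 + (matrix_inv (B - \<delta> (M1 ** M2) ** A ** matrix_inv (M1 ** M2))
              ** \<delta> M1 ** (B - \<delta> M2 ** A ** matrix_inv M2)) *v u2,
      M1 ** M2))"

section \<open>Akivis algebras\<close>

text \<open>Algebras are given by a carrier \<open>V\<close>, which is a subspace of a real vector space, and by
  operations of which only the values on \<open>V\<close> matter.\<close>

definition linear_map_on :: "'v::real_vector set \<Rightarrow> ('v \<Rightarrow> 'w::real_vector) \<Rightarrow> bool" where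
  "linear_map_on V f \<longleftrightarrow>
     (\<forall>x\<in>V. \<forall>y\<in>V. f (x + y) = f x + f y) \<and> (\<forall>c. \<forall>x\<in>V. f (c *\<^sub>R x) = c *\<^sub>R f x)"

definition akivis_algebra ::
  "'v::real_vector set \<Rightarrow> ('v \<Rightarrow> 'v \<Rightarrow> 'v) \<Rightarrow> ('v \<Rightarrow> 'v \<Rightarrow> 'v \<Rightarrow> 'v) \<Rightarrow> bool" where
  "akivis_algebra V br as \<longleftrightarrow>
     subspace V \<and>
     (\<forall>x\<in>V. \<forall>y\<in>V. br x y \<in> V) \<and>
     (\<forall>x\<in>V. linear_map_on V (\<lambda>y. br x y) \<and> linear_map_on V (\<lambda>y. br y x)) \<and>
     (\<forall>x\<in>V. \<forall>y\<in>V. br x y = - br y x) \<and>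
     (\<forall>x\<in>V. \<forall>y\<in>V. \<forall>z\<in>V. as x y z \<in> V) \<and>
     (\<forall>x\<in>V. \<forall>y\<in>V. linear_map_on V (\<lambda>z. as z x y) \<and>
        linear_map_on V (\<lambda>z. as x z y) \<and> linear_map_on V (\<lambda>z. as x y z)) \<and>
     (\<forall>x\<in>V. \<forall>y\<in>V. \<forall>z\<in>V.
        br (br x y) z + br (br z x) y + br (br y z) x =
        as x y z + as y z x + as z x y - as z y x - as x z y - as y x z)"

text \<open>Lie algebras are regarded as Akivis algebras with vanishing trilinear operation.\<close>

definition lie_subalgebra ::
  "('v::real_vector \<Rightarrow> 'v \<Rightarrow> 'v) \<Rightarrow> ('v \<Rightarrow> 'v \<Rightarrow> 'v \<Rightarrow> 'v) \<Rightarrow> 'v set \<Rightarrow> 'v set \<Rightarrow> bool" where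
  "lie_subalgebra br as V N \<longleftrightarrow>
     subspace N \<and> N \<subseteq> V \<and>
     (\<forall>x\<in>N. \<forall>y\<in>N. br x y \<in> N) \<and>
     (\<forall>x\<in>N. \<forall>y\<in>N. \<forall>z\<in>N. as x y z = 0) \<and>
     (\<forall>x\<in>N. \<forall>y\<in>N. \<forall>z\<in>N. br (br x y) z + br (br z x) y + br (br y z) x = 0)"

definition akivis_hom_into ::
  "('v::real_vector \<Rightarrow> 'v \<Rightarrow> 'v) \<Rightarrow> ('v \<Rightarrow> 'v \<Rightarrow> 'v \<Rightarrow> 'v) \<Rightarrow> 'v set \<Rightarrow> 'v set \<Rightarrow> ('v \<Rightarrow> 'v) \<Rightarrow> bool" where
  "akivis_hom_into br as V M \<alpha> \<longleftrightarrow>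
     \<alpha> \<in> V \<rightarrow> M \<and> linear_map_on V \<alpha> \<and>
     (\<forall>x\<in>V. \<forall>y\<in>V. \<alpha> (br x y) = br (\<alpha> x) (\<alpha> y)) \<and>
     (\<forall>x\<in>V. \<forall>y\<in>V. \<forall>z\<in>V. \<alpha> (as x y z) = as (\<alpha> x) (\<alpha> y) (\<alpha> z))"

definition akivis_semidirect_product ::
  "'v::real_vector set \<Rightarrow> ('v \<Rightarrow> 'v \<Rightarrow> 'v) \<Rightarrow> ('v \<Rightarrow> 'v \<Rightarrow> 'v \<Rightarrow> 'v) \<Rightarrow> 'v set \<Rightarrow> 'v set \<Rightarrow> bool" where
  "akivis_semidirect_product V br as N M \<longleftrightarrow>
     akivis_algebra V br as \<and> lie_subalgebra br as V N \<and> lie_subalgebra br as V M \<and>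
     (\<exists>\<alpha>. akivis_hom_into br as V M \<alpha> \<and> N = {x \<in> V. \<alpha> x = 0}) \<and>
     V = {x + y |x y. x \<in> N \<and> y \<in> M} \<and> N \<inter> M = {0}"

section \<open>The Akivis algebra of a loop on \<open>\<real>\<^sup>n \<times> \<Gamma>\<close>\<close>

definition exp_curve :: "(real^'n) \<times> (real^'n^'n) \<Rightarrow> real \<Rightarrow> (real^'n) \<times> (real^'n^'n)" where
  "exp_curve v t = (t *\<^sub>R fst v, mat_exp (t *\<^sub>R snd v))"

text \<open>The curve \<open>g\<close>, written near \<open>t = 0\<close> in the coordinates
  \<open>(x, exp m) \<leftrightarrow> (x, m)\<close> with \<open>m \<in> \<mm>\<close>, is \<open>c\<close>; the predicate says \<open>c t / t ^ k \<longrightarrow> v\<close>.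
  The values of \<open>c\<close> at \<open>t\<close> near \<open>0\<close> are determined by \<open>g\<close> because \<open>c\<close> tends to \<open>0\<close> and
  \<open>exp\<close> is injective near \<open>0\<close>.\<close>

definition has_coord_limit ::
  "(real^'n^'n) set \<Rightarrow> nat \<Rightarrow> (real \<Rightarrow> (real^'n) \<times> (real^'n^'n)) \<Rightarrow> (real^'n) \<times> (real^'n^'n) \<Rightarrow> bool" where
  "has_coord_limit \<mm> k g v \<longleftrightarrow>
     (\<exists>c. (\<forall>\<^sub>F t in at 0. snd (c t) \<in> \<mm> \<and> g t = (fst (c t), mat_exp (snd (c t)))) \<and>
          (c \<longlongrightarrow> 0) (at 0) \<and> ((\<lambda>t. (1 / t ^ k) *\<^sub>R c t) \<longlongrightarrow> v) (at 0))"

definition commutator_curve where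
  "commutator_curve L f v1 v2 t =
     (let X1 = exp_curve v1 t; X2 = exp_curve v2 t in right_div L f (f X1 X2) (f X2 X1))"

definition associator_curve where
  "associator_curve L f v1 v2 v3 t =
     (let X1 = exp_curve v1 t; X2 = exp_curve v2 t; X3 = exp_curve v3 t
      in right_div L f (f (f X1 X2) X3) (f X1 (f X2 X3)))"

definition loop_bracket where
  "loop_bracket L f \<mm> v1 v2 = (THE w. has_coord_limit \<mm> 2 (commutator_curve L f v1 v2) w)"

definition loop_associator where
  "loop_associator L f \<mm> v1 v2 v3 = (THE w. has_coord_limit \<mm> 3 (associator_curve L f v1 v2 v3) w)"

end

theory Submission
  imports Defs
begin

text \<open>For \<open>M\<close>, \<open>N\<close> in \<open>\<Gamma>\<close> put \<open>P(M) = B - M\<^sup>\<delta> A M\<^sup>-\<^sup>1\<close>, which is invertible by the eigenvalue condition, and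
  \<open>Q(M, N) = P(M N)\<^sup>-\<^sup>1 M\<^sup>\<delta> P(N)\<close>, so that \<open>(u, M) * (v, N) = (u + Q(M, N) v, M N)\<close>. The identities
  \<open>Q(M, N) = M + P(M N)\<^sup>-\<^sup>1 (M\<^sup>\<delta> B - B M)\<close> and \<open>Q(M, N S) Q(N, S) = Q(M N, S)\<close> reduce the commutator and the
  associator limits to first derivatives. With \<open>d\<close> the differential of \<open>\<delta>\<close> and \<open>R = (B - A)\<^sup>-\<^sup>1\<close> they give
  \<open>[(x, a), (y, b)] = (q(a) y - q(b) x, [a, b])\<close> with \<open>q(a) = a + R (d(a) B - B a)\<close>, and
  \<open>\<langle>(x, a), (y, b), (z, c)\<rangle> = (K(a, c) y, 0)\<close> with \<open>K(a, c) = R (A c - d(c) A) R (d(a) B - B a)\<close>.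
  The projection to the second component is the required homomorphism.

  The endomorphism \<open>\<delta>\<close> is not assumed to be smooth: since \<open>(B - A) Q(M, M\<^sup>-\<^sup>1) = M\<^sup>\<delta> B - A M\<close>, its
  differentiability follows from that of the loop multiplication. That the exponential map of \<open>\<mm>\<close> covers
  a neighbourhood of the identity in the manifold topology of \<open>\<Gamma>\<close> is obtained from Euler's scheme in a
  chart and an open mapping theorem.\<close>

section \<open>The matrix exponential\<close>

text \<open>The norm on \<open>real^'n^'n\<close> is the Frobenius norm. Each row of the product is
  a combination of the rows of \<open>Y\<close> with coefficients from the same row of
  \<open>X\<close>, so the bound is Cauchy-Schwarz row by row.\<close>

lemma norm_matrix_mult_le:
  fixes X Y :: "real^'n^'n"
  shows "norm (X ** Y) \<le> norm X * norm Y"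
proof -
  have row: "norm ((X ** Y) $ i) \<le> norm (X $ i) * norm Y" for i
  proof -
    have "(X ** Y) $ i = (\<Sum>k\<in>UNIV. (X $ i $ k) *\<^sub>R (Y $ k))"
      by (simp add: matrix_matrix_mult_def vec_eq_iff)
    then have "norm ((X ** Y) $ i) \<le> (\<Sum>k\<in>UNIV. \<bar>X $ i $ k\<bar> * \<bar>norm (Y $ k)\<bar>)"
      by (simp add: sum_norm_le)
    also have "\<dots> \<le> L2_set (\<lambda>k. X $ i $ k) UNIV * L2_set (\<lambda>k. norm (Y $ k)) UNIV"
      by (rule L2_set_mult_ineq)
    also have "\<dots> = norm (X $ i) * norm Y"
      by (simp add: norm_vec_def L2_set_def)
    finally show ?thesis .
  qed
  have "norm (X ** Y) \<le> L2_set (\<lambda>i. norm (X $ i) * norm Y) UNIV"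
    unfolding norm_vec_def[of "X ** Y"] by (rule L2_set_mono) (auto simp: row)
  also have "\<dots> = norm X * norm Y"
    by (simp add: L2_set_left_distrib norm_vec_def[of X])
  finally show ?thesis .
qed

text \<open>The ring product \<open>*\<close> on this type is componentwise; this interpretation
  supplies limits and derivatives for \<open>**\<close>.\<close>

interpretation mm: bounded_bilinear "(**) :: real^'n^'n \<Rightarrow> real^'n^'n \<Rightarrow> real^'n^'n"
proof
  show "\<exists>K. \<forall>(a :: real^'n^'n) (b :: real^'n^'n). norm (a ** b) \<le> norm a * norm b * K"
    by (intro exI[of _ 1]) (simp add: norm_matrix_mult_le)
qed (simp_all add: matrix_matrix_mult_def vec_eq_iff algebra_simps sum.distrib sum_distrib_left)

lemmas matrix_ring_simps = mm.add_left mm.add_right mm.diff_left mm.diff_right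
  mm.minus_left mm.minus_right mm.scaleR_left mm.scaleR_right matrix_mul_assoc

section \<open>Powers of a matrix and the exponential series\<close>

definition mpow :: "real^'n^'n \<Rightarrow> nat \<Rightarrow> real^'n^'n" where
  "mpow X k = ((**) X ^^ k) (mat 1)"

lemma mpow_0 [simp]: "mpow X 0 = mat 1"
  and mpow_Suc: "mpow X (Suc k) = X ** mpow X k"
  by (simp_all add: mpow_def)

lemma mpow_commute: "X ** mpow X k = mpow X k ** X"
proof (induction k)
  case (Suc k)
  then show ?case by (metis mpow_Suc matrix_mul_assoc)
qed simp

lemma mpow_scaleR: "mpow (t *\<^sub>R X) k = t ^ k *\<^sub>R mpow X k"
  by (induction k) (simp_all add: mpow_Suc mm.scaleR_left mm.scaleR_right)

lemma norm_mpow_le: "norm (mpow X k) \<le> norm X ^ k * norm (mat 1 :: real^'n^'n)"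
  for X :: "real^'n^'n"
proof (induction k)
  case (Suc k)
  have "norm (mpow X (Suc k)) \<le> norm X * norm (mpow X k)"
    by (simp add: mpow_Suc norm_matrix_mult_le)
  also have "\<dots> \<le> norm X * (norm X ^ k * norm (mat 1 :: real^'n^'n))"
    by (intro mult_left_mono Suc.IH) auto
  finally show ?case by (simp add: mult_ac)
qed simp

text \<open>The Frobenius norm of \<open>mat 1\<close> is not \<open>1\<close> in general. Positive
  powers need no factor \<open>norm (mat 1)\<close>, since the induction can start at
  \<open>X\<close> itself.\<close>

lemma norm_mpow_Suc_le: "norm (mpow X (Suc k)) \<le> norm X ^ Suc k"
proof (induction k)
  case (Suc k)
  have "norm (mpow X (Suc (Suc k))) \<le> norm X * norm (mpow X (Suc k))"
    by (metis mpow_Suc norm_matrix_mult_le)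
  also have "\<dots> \<le> norm X * norm X ^ Suc k"
    by (intro mult_left_mono Suc.IH) auto
  finally show ?case by simp
qed (simp add: mpow_Suc)

lemma summable_mat_exp:
  fixes X :: "real^'n^'n"
  shows "summable (\<lambda>k. (1 / fact k) *\<^sub>R mpow X k)"
proof (rule summable_comparison_test)
  show "\<exists>N. \<forall>k\<ge>N. norm ((1 / fact k) *\<^sub>R mpow X k) \<le> (inverse (fact k) * norm X ^ k) * norm (mat 1 :: real^'n^'n)"
    using norm_mpow_le[of X] by (intro exI[of _ 0]) (auto simp: field_simps)
  show "summable (\<lambda>k. (inverse (fact k) * norm X ^ k) * norm (mat 1 :: real^'n^'n))"
    by (intro summable_mult2 summable_exp)
qed

lemma mat_exp_eq: "mat_exp X = (\<Sum>k. (1 / fact k) *\<^sub>R mpow X k)"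
  by (simp add: mat_exp_def mpow_def)

lemma mat_exp_0 [simp]: "mat_exp (0 :: real^'n^'n) = mat 1"
proof -
  have "(\<Sum>k. (1 / fact k) *\<^sub>R mpow (0 :: real^'n^'n) k)
      = (\<Sum>k\<in>{0}. (1 / fact k) *\<^sub>R mpow (0 :: real^'n^'n) k)"
  proof (rule suminf_finite)
    show "(1 / fact k) *\<^sub>R mpow (0 :: real^'n^'n) k = 0" if "k \<notin> {0}" for k
      using that by (cases k) (auto simp: mpow_Suc)
  qed simp
  then show ?thesis by (simp add: mat_exp_eq)
qed

text \<open>One factor is exchanged at a time:
  \<open>X^(k+2) - Y^(k+2) = X (X^(k+1) - Y^(k+1)) + (X - Y) Y^(k+1)\<close>.\<close>

lemma norm_mpow_diff_le:
  assumes "norm X \<le> r" "norm Y \<le> r"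
  shows "norm (mpow X (Suc k) - mpow Y (Suc k)) \<le> real (Suc k) * r ^ k * norm (X - Y)"
proof (induction k)
  case (Suc k)
  have r: "0 \<le> r" using assms norm_ge_zero order_trans by blast
  have "mpow X (Suc (Suc k)) - mpow Y (Suc (Suc k))
      = X ** (mpow X (Suc k) - mpow Y (Suc k)) + (X - Y) ** mpow Y (Suc k)"
    by (simp add: mpow_Suc matrix_ring_simps)
  then have "norm (mpow X (Suc (Suc k)) - mpow Y (Suc (Suc k)))
      \<le> norm X * norm (mpow X (Suc k) - mpow Y (Suc k)) + norm (X - Y) * norm (mpow Y (Suc k))"
    using norm_matrix_mult_le norm_triangle_mono by metis
  also have "\<dots> \<le> r * (real (Suc k) * r ^ k * norm (X - Y)) + norm (X - Y) * r ^ Suc k"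
    using Suc.IH assms r norm_mpow_Suc_le[of Y k] power_mono[OF assms(2) norm_ge_zero, of "Suc k"]
    by (intro add_mono mult_mono) auto
  finally show ?case by (simp add: algebra_simps)
qed (simp add: mpow_Suc)

text \<open>The terms of order 0 and 1 of the two series account for \<open>X - Y\<close>; the
  others are bounded by \<open>norm_mpow_diff_le\<close> and sum to a shifted exponential series.
  Injectivity of the exponential near 0, its derivative at 0 and its continuity are all read off
  from this estimate.\<close>

lemma norm_mat_exp_diff_linear_le:
  assumes "norm X \<le> r" "norm Y \<le> r"
  shows "norm (mat_exp X - mat_exp Y - (X - Y)) \<le> (exp r - 1) * norm (X - Y)"
proof -
  let ?a = "\<lambda>k. (1 / fact k) *\<^sub>R mpow X k - (1 / fact k) *\<^sub>R mpow Y k"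
  let ?e = "\<lambda>k. r ^ k /\<^sub>R fact k"
  have sa: "summable ?a"
    by (intro summable_diff summable_mat_exp)
  have "suminf ?a = mat_exp X - mat_exp Y"
    unfolding mat_exp_eq by (rule suminf_diff[symmetric]; rule summable_mat_exp)
  also have "suminf ?a = (\<Sum>k. ?a (k + 2)) + (\<Sum>k<2. ?a k)"
    by (rule suminf_split_initial_segment[OF sa])
  also have "(\<Sum>k<2. ?a k) = X - Y"
    by (simp add: numeral_2_eq_2 mpow_Suc)
  finally have eq: "mat_exp X - mat_exp Y - (X - Y) = (\<Sum>k. ?a (k + 2))"
    by (rule diff_eq_eq[THEN iffD2, OF sym])
  have se: "summable ?e" by (rule summable_exp_generic)
  have "exp r = (\<Sum>k. ?e (k + 1)) + (\<Sum>k<1. ?e k)"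
    unfolding exp_def by (rule suminf_split_initial_segment[OF se])
  then have e1: "(\<Sum>k. ?e (k + 1)) = exp r - 1" by simp
  have "norm (\<Sum>k. ?a (k + 2)) \<le> (\<Sum>k. ?e (k + 1) * norm (X - Y))"
  proof (rule norm_suminf_le)
    show "summable (\<lambda>k. ?e (k + 1) * norm (X - Y))"
      using summable_ignore_initial_segment[OF se, of 1] by (rule summable_mult2)
    fix k
    have "?a (k + 2) = (1 / fact (k + 2)) *\<^sub>R (mpow X (Suc (Suc k)) - mpow Y (Suc (Suc k)))"
      by (simp add: algebra_simps)
    then have "norm (?a (k + 2)) = (1 / fact (k + 2)) * norm (mpow X (Suc (Suc k)) - mpow Y (Suc (Suc k)))"
      by (simp only: norm_scaleR) simp
    also have "\<dots> \<le> (1 / fact (k + 2)) * (real (Suc (Suc k)) * r ^ Suc k * norm (X - Y))"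
      by (rule mult_left_mono[OF norm_mpow_diff_le[OF assms]]) simp
    \<comment> \<open>The factor \<open>k + 2\<close> cancels against \<open>fact (k + 2)\<close>,
      which leaves the exponential series from index 1 on and hence
      \<open>exp r - 1\<close>.\<close>
    also have "\<dots> = ?e (k + 1) * norm (X - Y)"
    proof -
      have "fact (k + 2) = real (Suc (Suc k)) * fact (k + 1)" by simp
      then show ?thesis
        by (simp only:) (simp add: field_simps del: of_nat_Suc fact_Suc power_Suc)
    qed
    finally show "norm (?a (k + 2)) \<le> ?e (k + 1) * norm (X - Y)" .
  qed
  also have "\<dots> = (exp r - 1) * norm (X - Y)"
    by (subst suminf_mult2[OF summable_ignore_initial_segment[OF se, of 1], symmetric]) (simp only: e1)
  finally show ?thesis using eq by simp
qed

text \<open>For \<open>r \<le> 1\<close> the bound \<open>exp r \<le> 1 + r + r^2\<close> turns the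
  constant into \<open>2 * r\<close>, which tends to 0 with \<open>r\<close>.\<close>

lemma norm_mat_exp_diff_linear_le_small:
  assumes "norm X \<le> r" "norm Y \<le> r" "r \<le> 1"
  shows "norm (mat_exp X - mat_exp Y - (X - Y)) \<le> 2 * r * norm (X - Y)"
proof -
  have r: "0 \<le> r" using assms norm_ge_zero order_trans by blast
  have "r\<^sup>2 \<le> r" using r assms(3) by (simp add: power2_eq_square mult_left_le)
  then have "exp r - 1 \<le> 2 * r" using exp_bound[OF r assms(3)] by linarith
  then show ?thesis
    using norm_mat_exp_diff_linear_le[OF assms(1,2)]
    by (meson mult_right_mono norm_ge_zero order_trans)
qed

text \<open>At radius \<open>1/4\<close> the deviation of the exponential from the identity map
  costs at most half of \<open>norm (X - Y)\<close>. Logarithms in this ball are therefore unique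
  and controlled by the distance of the exponentials.\<close>

lemma mat_exp_lower_lipschitz:
  assumes "norm X \<le> 1/4" "norm Y \<le> 1/4"
  shows "norm (X - Y) \<le> 2 * norm (mat_exp X - mat_exp Y)"
proof -
  have "norm (X - Y) \<le> norm (mat_exp X - mat_exp Y) + norm (mat_exp X - mat_exp Y - (X - Y))"
    by (metis norm_minus_commute norm_triangle_sub)
  then show ?thesis
    using norm_mat_exp_diff_linear_le_small[OF assms] by simp
qed

lemma mat_exp_has_derivative_0: "((mat_exp :: real^'n^'n \<Rightarrow> _) has_derivative (\<lambda>X. X)) (at 0)"
proof (rule has_derivativeI_sandwich[where e = 1 and H = "\<lambda>X. 2 * norm X"])
  fix X :: "real^'n^'n" assume "X \<noteq> 0" "dist X 0 < 1"
  then show "norm (mat_exp X - mat_exp 0 - (X - 0)) / norm (X - 0) \<le> 2 * norm X"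
    using norm_mat_exp_diff_linear_le_small[of X "norm X" 0]
    by (simp add: divide_simps)
next
  show "((\<lambda>X :: real^'n^'n. 2 * norm X) \<longlongrightarrow> 0) (at 0)"
    by (auto intro!: tendsto_eq_intros)
qed auto

lemma continuous_on_mat_exp: "continuous_on S (mat_exp :: real^'n^'n \<Rightarrow> _)"
proof (rule continuous_on_subset)
  have "isCont mat_exp X" for X :: "real^'n^'n"
    unfolding isCont_def
  proof (rule LIM_zero_cancel, rule Lim_null_comparison)
    let ?r = "norm X + 1"
    show "\<forall>\<^sub>F Y in at X. norm (mat_exp Y - mat_exp X) \<le> exp ?r * norm (Y - X)"
      unfolding eventually_at
    proof (intro exI[of _ 1] conjI ballI impI)
      fix Y assume "Y \<noteq> X \<and> dist Y X < 1"
      then have "norm Y \<le> ?r"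
        by (smt (verit) dist_norm norm_triangle_sub)
      then have "norm (mat_exp Y - mat_exp X - (Y - X)) \<le> (exp ?r - 1) * norm (Y - X)"
        by (intro norm_mat_exp_diff_linear_le) auto
      then show "norm (mat_exp Y - mat_exp X) \<le> exp ?r * norm (Y - X)"
        using norm_triangle_sub[of "mat_exp Y - mat_exp X" "Y - X"] by (simp add: algebra_simps)
    qed auto
    show "((\<lambda>Y. exp ?r * norm (Y - X)) \<longlongrightarrow> 0) (at X)"
      by (auto intro!: tendsto_eq_intros)
  qed
  then show "continuous_on UNIV (mat_exp :: real^'n^'n \<Rightarrow> _)"
    by (simp add: continuous_at_imp_continuous_on)
qed simp

section \<open>The exponential as a one-parameter group\<close>

lemma mat_exp_scaleR_inner:
  "mat_exp (s *\<^sub>R X) \<bullet> b = (\<Sum>k. (mpow X k \<bullet> b / fact k) * s ^ k)"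
  "summable (\<lambda>k. (mpow X k \<bullet> b / fact k) * s ^ k)"
proof -
  have eq: "((1 / fact k) *\<^sub>R mpow (s *\<^sub>R X) k) \<bullet> b = (mpow X k \<bullet> b / fact k) * s ^ k" for k
    by (simp add: mpow_scaleR)
  show "mat_exp (s *\<^sub>R X) \<bullet> b = (\<Sum>k. (mpow X k \<bullet> b / fact k) * s ^ k)"
    using bounded_linear.suminf[OF bounded_linear_inner_left[of b] summable_mat_exp[of "s *\<^sub>R X"]]
    by (simp only: mat_exp_eq eq)
  show "summable (\<lambda>k. (mpow X k \<bullet> b / fact k) * s ^ k)"
    using bounded_linear.summable[OF bounded_linear_inner_left[of b] summable_mat_exp[of "s *\<^sub>R X"]]
    by (simp only: eq)
qed

lemma mat_exp_commute: "X ** mat_exp (s *\<^sub>R X) = mat_exp (s *\<^sub>R X) ** X"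
proof -
  have "X ** mpow (s *\<^sub>R X) k = mpow (s *\<^sub>R X) k ** X" for k
    by (simp add: mpow_scaleR matrix_ring_simps mpow_commute)
  then show ?thesis
    unfolding mat_exp_eq
    using bounded_linear.suminf[OF mm.bounded_linear_right[of X] summable_mat_exp[of "s *\<^sub>R X"]]
      bounded_linear.suminf[OF mm.bounded_linear_left[of X] summable_mat_exp[of "s *\<^sub>R X"]]
    by (simp add: mm.scaleR_left mm.scaleR_right)
qed

text \<open>The inner product with a basis element is a scalar power series in \<open>s\<close>, so
  termwise differentiation applies in each coordinate.\<close>

lemma mat_exp_has_vector_derivative:
  fixes X :: "real^'n^'n"
  shows "((\<lambda>s. mat_exp (s *\<^sub>R X)) has_vector_derivative (X ** mat_exp (s *\<^sub>R X))) (at s)"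
  unfolding has_vector_derivative_def
proof (subst has_derivative_componentwise_within, intro ballI)
  fix b :: "real^'n^'n" assume "b \<in> Basis"
  let ?c = "\<lambda>k. mpow X k \<bullet> b / fact k"
  have "((\<lambda>s. mat_exp (s *\<^sub>R X) \<bullet> b) has_field_derivative (\<Sum>k. diffs ?c k * s ^ k)) (at s)"
    unfolding mat_exp_scaleR_inner(1)
    by (rule termdiffs_strong_converges_everywhere) (rule mat_exp_scaleR_inner(2))
  moreover have "(\<Sum>k. diffs ?c k * s ^ k) = (X ** mat_exp (s *\<^sub>R X)) \<bullet> b"
  proof -
    have "diffs ?c k * s ^ k = (X ** ((1 / fact k) *\<^sub>R mpow (s *\<^sub>R X) k)) \<bullet> b" for k
      by (simp add: diffs_def mpow_scaleR mpow_Suc mm.scaleR_right field_simps del: of_nat_Suc)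
    moreover have "bounded_linear (\<lambda>Y. (X ** Y) \<bullet> b)"
      by (rule bounded_linear_compose[OF bounded_linear_inner_left mm.bounded_linear_right])
    ultimately show ?thesis
      unfolding mat_exp_eq
      using bounded_linear.suminf[OF _ summable_mat_exp[of "s *\<^sub>R X"], of "\<lambda>Y. (X ** Y) \<bullet> b"] by simp
  qed
  ultimately show "((\<lambda>s. mat_exp (s *\<^sub>R X) \<bullet> b) has_derivative (\<lambda>h. (h *\<^sub>R (X ** mat_exp (s *\<^sub>R X))) \<bullet> b)) (at s)"
    by (simp add: has_field_derivative_def mult_commute_abs)
qed

text \<open>The product of the exponentials at \<open>s + t - u\<close> and at \<open>u\<close> has
  zero derivative in \<open>u\<close>, because \<open>X\<close> commutes with its exponentials. The
  values at \<open>u = 0\<close> and \<open>u = t\<close> are the two sides.\<close>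

lemma mat_exp_add: "mat_exp ((s + t) *\<^sub>R X) = mat_exp (s *\<^sub>R X) ** mat_exp (t *\<^sub>R X)"
proof -
  let ?G = "\<lambda>u. mat_exp ((s + t - u) *\<^sub>R X) ** mat_exp (u *\<^sub>R X)"
  have "(?G has_derivative (\<lambda>h. 0)) (at u)" for u
  proof -
    have "((\<lambda>u. mat_exp ((s + t - u) *\<^sub>R X)) has_vector_derivative
        (- 1) *\<^sub>R (X ** mat_exp ((s + t - u) *\<^sub>R X))) (at u)"
      by (rule vector_diff_chain_at[OF _ mat_exp_has_vector_derivative, unfolded o_def])
        (auto intro!: derivative_eq_intros simp flip: has_real_derivative_iff_has_vector_derivative)
    from mm.has_vector_derivative[OF this mat_exp_has_vector_derivative[of X u]]
    have "(?G has_vector_derivative 0) (at u)"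
      by (simp add: mm.minus_left mat_exp_commute flip: matrix_mul_assoc)
    then show ?thesis by (simp add: has_vector_derivative_def)
  qed
  then have "?G 0 = ?G t"
    by (intro has_derivative_zero_unique[of UNIV]) auto
  then show ?thesis by simp
qed

lemma mat_exp_eq_mpow: "mpow (mat_exp ((1 / real (Suc n)) *\<^sub>R X)) (Suc n) = mat_exp X"
proof -
  have "mpow (mat_exp (s *\<^sub>R X)) k = mat_exp ((real k * s) *\<^sub>R X)" for s k
    by (induction k) (simp_all add: mpow_Suc mat_exp_add[symmetric] algebra_simps)
  then show ?thesis by simp
qed

section \<open>Powers of matrices near the identity and Euler's limit\<close>

lemma norm_one_plus_mult_le:
  fixes X Z :: "real^'n^'n"
  shows "norm (X ** Z) \<le> (1 + norm (X - mat 1)) * norm Z"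
proof -
  have "norm (X ** Z) = norm (Z + (X - mat 1) ** Z)" by (simp add: matrix_ring_simps)
  also have "\<dots> \<le> norm Z + norm (X - mat 1) * norm Z"
    by (rule norm_triangle_mono[OF order_refl norm_matrix_mult_le])
  finally show ?thesis by (simp add: algebra_simps)
qed

lemma norm_mpow_le_one_plus:
  fixes X :: "real^'n^'n"
  shows "norm (mpow X k) \<le> (1 + norm (X - mat 1)) ^ k * norm (mat 1 :: real^'n^'n)"
proof (induction k)
  case (Suc k)
  have "norm (mpow X (Suc k)) \<le> (1 + norm (X - mat 1)) * norm (mpow X k)"
    unfolding mpow_Suc by (rule norm_one_plus_mult_le)
  also have "\<dots> \<le> (1 + norm (X - mat 1)) * ((1 + norm (X - mat 1)) ^ k * norm (mat 1 :: real^'n^'n))"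
    by (intro mult_left_mono Suc.IH) auto
  finally show ?case by simp
qed simp

text \<open>Intended for \<open>c\<close> of order \<open>1 / k\<close>: then
  \<open>(1 + c) ^ k\<close> stays bounded, and an error \<open>o(1 / k)\<close> in the factor is
  still negligible after taking \<open>k\<close>-th powers.\<close>

lemma norm_mpow_diff_le_one_plus:
  fixes X Y :: "real^'n^'n"
  assumes "norm (X - mat 1) \<le> c" "norm (Y - mat 1) \<le> c"
  shows "norm (mpow X k - mpow Y k) \<le> real k * (1 + c) ^ k * norm (mat 1 :: real^'n^'n) * norm (X - Y)"
proof (induction k)
  case (Suc k)
  let ?K = "norm (mat 1 :: real^'n^'n)"
  have c: "0 \<le> c" using assms norm_ge_zero order_trans by blast
  have "mpow X (Suc k) - mpow Y (Suc k) = X ** (mpow X k - mpow Y k) + (X - Y) ** mpow Y k"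
    by (simp add: mpow_Suc matrix_ring_simps)
  then have "norm (mpow X (Suc k) - mpow Y (Suc k))
      \<le> (1 + norm (X - mat 1)) * norm (mpow X k - mpow Y k) + norm (X - Y) * norm (mpow Y k)"
    using norm_matrix_mult_le norm_one_plus_mult_le norm_triangle_mono by metis
  also have "\<dots> \<le> (1 + c) * (real k * (1 + c) ^ k * ?K * norm (X - Y)) + norm (X - Y) * ((1 + c) ^ Suc k * ?K)"
  proof (intro add_mono mult_mono Suc.IH)
    have "norm (mpow Y k) \<le> (1 + norm (Y - mat 1)) ^ k * ?K"
      by (rule norm_mpow_le_one_plus)
    also have "\<dots> \<le> (1 + c) ^ k * ?K"
      using assms by (intro mult_right_mono power_mono) auto
    also have "\<dots> \<le> (1 + c) ^ Suc k * ?K"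
      using c by (intro mult_right_mono power_increasing) auto
    finally show "norm (mpow Y k) \<le> (1 + c) ^ Suc k * ?K" .
  qed (use assms c in auto)
  finally show ?case by (simp add: algebra_simps)
qed simp

lemma has_vector_derivative_quotient_tendsto:
  fixes f :: "real \<Rightarrow> 'a::real_normed_vector"
  assumes "(f has_vector_derivative f') (at 0)"
  shows "((\<lambda>t. (1 / t) *\<^sub>R (f t - f 0)) \<longlongrightarrow> f') (at 0)"
proof -
  have "((\<lambda>t. (1 / norm (t - 0)) *\<^sub>R (f t - (f 0 + (t - 0) *\<^sub>R f'))) \<longlongrightarrow> 0) (at 0)"
    using assms unfolding has_vector_derivative_def has_derivative_at2 by simp
  \<comment> \<open>The factor \<open>sgn t\<close> turns \<open>1 / norm t\<close> into
    \<open>1 / t\<close> without affecting convergence to 0.\<close>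
  then have "((\<lambda>t. sgn t *\<^sub>R ((1 / norm (t - 0)) *\<^sub>R (f t - (f 0 + (t - 0) *\<^sub>R f')))) \<longlongrightarrow> 0) (at 0)"
    by (rule Lim_null_comparison[rotated, OF tendsto_norm_zero]) (auto simp: eventually_at sgn_real_def intro!: exI[of _ 1])
  then have "((\<lambda>t. sgn t *\<^sub>R ((1 / norm (t - 0)) *\<^sub>R (f t - (f 0 + (t - 0) *\<^sub>R f'))) + f') \<longlongrightarrow> f') (at 0)"
    using tendsto_add[OF _ tendsto_const[of f']] by fastforce
  then show ?thesis
    by (rule Lim_transform_eventually)
      (auto simp: eventually_at sgn_real_def algebra_simps divide_simps intro!: exI[of _ 1])
qed

lemma has_vector_derivative_quotient_LIMSEQ:
  fixes f :: "real \<Rightarrow> 'a::real_normed_vector"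
  assumes "(f has_vector_derivative f') (at 0)"
  shows "(\<lambda>n. real (Suc n) *\<^sub>R (f (1 / real (Suc n)) - f 0)) \<longlonglongrightarrow> f'"
proof -
  have "(\<lambda>n. 1 / real (Suc n)) \<longlonglongrightarrow> 0"
    using LIMSEQ_inverse_real_of_nat by (simp add: inverse_eq_divide)
  then have "filterlim (\<lambda>n. 1 / real (Suc n)) (at 0) sequentially"
    by (rule filterlim_atI) simp
  from filterlim_compose[OF has_vector_derivative_quotient_tendsto[OF assms] this]
  show ?thesis by simp
qed

lemma eventually_norm_diff_le:
  fixes f :: "real \<Rightarrow> 'a::real_normed_vector"
  assumes "(f has_vector_derivative f') (at 0)" "norm f' < c"
  shows "\<forall>\<^sub>F n in sequentially. norm (f (1 / real (Suc n)) - f 0) \<le> c / real (Suc n)"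
proof -
  have "\<forall>\<^sub>F n in sequentially. norm (real (Suc n) *\<^sub>R (f (1 / real (Suc n)) - f 0)) < c"
    using tendsto_norm[OF has_vector_derivative_quotient_LIMSEQ[OF assms(1)]] assms(2)
    by (rule order_tendstoD)
  then show ?thesis
    by (rule eventually_mono) (simp add: pos_le_divide_eq mult.commute del: of_nat_Suc)
qed

text \<open>The exponential of \<open>X\<close> is the \<open>n\<close>-th power of that of
  \<open>X / n\<close>. The latter and \<open>\<gamma> (1 / n)\<close> lie within
  \<open>O(1 / n)\<close> of the identity and differ by \<open>o(1 / n)\<close>, so their
  \<open>n\<close>-th powers have the same limit.\<close>

lemma mpow_tendsto_mat_exp:
  fixes \<gamma> :: "real \<Rightarrow> real^'n^'n"
  assumes "(\<gamma> has_vector_derivative X) (at 0)" "\<gamma> 0 = mat 1"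
  shows "(\<lambda>n. mpow (\<gamma> (1 / real (Suc n))) (Suc n)) \<longlonglongrightarrow> mat_exp X"
proof -
  let ?K = "norm (mat 1 :: real^'n^'n)"
  let ?h = "\<lambda>n. 1 / real (Suc n)"
  let ?b = "\<lambda>n. mat_exp (?h n *\<^sub>R X)"
  have dexp: "((\<lambda>s. mat_exp (s *\<^sub>R X)) has_vector_derivative X) (at 0)"
    using mat_exp_has_vector_derivative[of X 0] by simp
  have q1: "(\<lambda>n. real (Suc n) *\<^sub>R (\<gamma> (?h n) - mat 1)) \<longlonglongrightarrow> X"
    using has_vector_derivative_quotient_LIMSEQ[OF assms(1)] assms(2) by simp
  have q2: "(\<lambda>n. real (Suc n) *\<^sub>R (?b n - mat 1)) \<longlonglongrightarrow> X"
    using has_vector_derivative_quotient_LIMSEQ[OF dexp] by simp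
  \<comment> \<open>\<open>c\<close> only has to exceed the norm of the common velocity
    \<open>X\<close>; then both factors are eventually within \<open>c / n\<close> of the
    identity.\<close>
  define c where "c = norm X + 1"
  have c: "0 < c" "norm X < c" by (simp_all add: c_def add_nonneg_pos)
  have "(\<lambda>n. mpow (\<gamma> (?h n)) (Suc n) - mpow (?b n) (Suc n)) \<longlonglongrightarrow> 0"
  proof (rule Lim_null_comparison)
    show "\<forall>\<^sub>F n in sequentially. norm (mpow (\<gamma> (?h n)) (Suc n) - mpow (?b n) (Suc n))
        \<le> exp c * ?K * norm (real (Suc n) *\<^sub>R (\<gamma> (?h n) - mat 1) - real (Suc n) *\<^sub>R (?b n - mat 1))"
      using eventually_norm_diff_le[OF assms(1) c(2)] eventually_norm_diff_le[OF dexp c(2)]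
    proof eventually_elim
      case (elim n)
      have "norm (mpow (\<gamma> (?h n)) (Suc n) - mpow (?b n) (Suc n))
          \<le> real (Suc n) * (1 + c / real (Suc n)) ^ Suc n * ?K * norm (\<gamma> (?h n) - ?b n)"
        by (rule norm_mpow_diff_le_one_plus) (use elim assms(2) in simp_all)
      also have "\<dots> \<le> real (Suc n) * exp c * ?K * norm (\<gamma> (?h n) - ?b n)"
      proof -
        have "1 + c / real (Suc n) \<le> exp (c / real (Suc n))"
          by (rule exp_ge_add_one_self)
        then have "(1 + c / real (Suc n)) ^ Suc n \<le> exp (c / real (Suc n)) ^ Suc n"
          using c by (intro power_mono) (auto intro: add_nonneg_nonneg)
        also have "\<dots> = exp c"
          by (subst exp_of_nat_mult[symmetric]) simp
        finally show ?thesis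
          by (intro mult_right_mono mult_left_mono) auto
      qed
      also have "\<dots> = exp c * ?K * norm (real (Suc n) *\<^sub>R (\<gamma> (?h n) - mat 1) - real (Suc n) *\<^sub>R (?b n - mat 1))"
        by (simp add: scaleR_diff_right[symmetric] del: of_nat_Suc)
      finally show ?case .
    qed
    show "(\<lambda>n. exp c * ?K * norm (real (Suc n) *\<^sub>R (\<gamma> (?h n) - mat 1) - real (Suc n) *\<^sub>R (?b n - mat 1))) \<longlonglongrightarrow> 0"
      using tendsto_mult_right_zero[OF tendsto_norm_zero[OF LIM_zero[OF tendsto_diff[OF q1 q2]]]] by simp
  qed
  from tendsto_add[OF this tendsto_const[of "mat_exp X"]] show ?thesis
    unfolding mat_exp_eq_mpow by simp
qed

section \<open>The exponential map in a chart\<close>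

text \<open>The injective derivative at \<open>p\<close> is bounded below by some \<open>B\<close>.
  On a small ball the derivative differs from it by at most \<open>B / 2\<close>, and the mean value
  inequality transfers the remaining \<open>B / 2\<close> to \<open>\<iota>\<close> itself.\<close>

lemma C1_immersion_lower_lipschitz:
  fixes \<iota> :: "'k::euclidean_space \<Rightarrow> 'b::euclidean_space"
  assumes "open S" "p \<in> S"
    and diff: "\<And>x. x \<in> S \<Longrightarrow> \<iota> differentiable (at x)"
    and cont: "\<And>v. continuous_on S (\<lambda>x. frechet_derivative \<iota> (at x) v)"
    and inj: "inj (frechet_derivative \<iota> (at p))"
  obtains c e where "0 < c" "0 < e" "cball p e \<subseteq> S"
    "\<And>x y. x \<in> cball p e \<Longrightarrow> y \<in> cball p e \<Longrightarrow> c * norm (x - y) \<le> norm (\<iota> x - \<iota> y)"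
proof -
  let ?D = "\<lambda>x. frechet_derivative \<iota> (at x)"
  have der: "(\<iota> has_derivative ?D x) (at x)" if "x \<in> S" for x
    using diff[OF that] by (simp add: frechet_derivative_works)
  have lin: "bounded_linear (?D x)" if "x \<in> S" for x
    using der[OF that] by (rule has_derivative_bounded_linear)
  obtain B where B: "B > 0" "\<And>v. B * norm v \<le> norm (?D p v)"
    using linear_inj_bounded_below_pos[OF _ inj] lin[OF \<open>p \<in> S\<close>] bounded_linear.linear by blast
  \<comment> \<open>\<open>?g\<close> dominates the operator norm of the difference of the
    derivatives, and its continuity follows from that of the derivative in fixed directions.\<close>
  let ?g = "\<lambda>x. \<Sum>b\<in>Basis. norm (?D x b - ?D p b)"
  have "continuous_on S ?g"
    by (intro continuous_intros cont)
  then have "(?g \<longlongrightarrow> ?g p) (at p)"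
    using \<open>p \<in> S\<close> unfolding continuous_on_eq_continuous_at[OF \<open>open S\<close>] isCont_def by (rule bspec)
  then have "(?g \<longlongrightarrow> ?g p) (nhds p)"
    by (rule tendsto_at_iff_tendsto_nhds[THEN iffD1])
  then have "\<forall>\<^sub>F x in nhds p. ?g x < B / 2"
    by (rule order_tendstoD(2)) (use B(1) in simp)
  moreover have "\<forall>\<^sub>F x in nhds p. x \<in> S"
    using assms(1,2) by (rule eventually_nhds_in_open)
  ultimately have "\<forall>\<^sub>F x in nhds p. x \<in> S \<and> ?g x < B / 2"
    by eventually_elim simp
  then obtain e where e: "e > 0" "\<And>x. dist x p \<le> e \<Longrightarrow> x \<in> S \<and> ?g x < B / 2"
    unfolding eventually_nhds_metric_le by blast
  show thesis
  proof (rule that[of "B / 2" e])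
    show sub: "cball p e \<subseteq> S" using e by (auto simp: dist_commute)
    fix x y assume xy: "x \<in> cball p e" "y \<in> cball p e"
    have "norm (\<iota> x - \<iota> y - ?D p (x - y)) \<le> norm (x - y) * (B / 2)"
    proof (rule differentiable_bound_linearization[where S = "cball p e"])
      show "y + t *\<^sub>R (x - y) \<in> cball p e" if "t \<in> {0..1}" for t
        using convexD_alt[OF convex_cball xy(2) xy(1), of t] that by (simp add: algebra_simps)
      show "(\<iota> has_derivative ?D z) (at z within cball p e)" if "z \<in> cball p e" for z
        using der sub that by (blast intro: has_derivative_at_withinI)
      show "onorm (?D z - ?D p) \<le> B / 2" if "z \<in> cball p e" for z
      proof -
        have "bounded_linear (\<lambda>v. ?D z v - ?D p v)"
          using lin sub that \<open>p \<in> S\<close> by (intro bounded_linear_sub) auto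
        then have "onorm (\<lambda>v. ?D z v - ?D p v) \<le> ?g z"
          by (rule onorm_componentwise)
        also have "\<dots> \<le> B / 2" using e(2)[of z] that by (simp add: dist_commute less_imp_le)
        finally show ?thesis by (simp add: fun_diff_def)
      qed
    qed (use e(1) in auto)
    moreover have "norm (?D p (x - y)) \<le> norm (\<iota> x - \<iota> y) + norm (\<iota> x - \<iota> y - ?D p (x - y))"
      by (metis norm_minus_commute norm_triangle_sub)
    ultimately show "B / 2 * norm (x - y) \<le> norm (\<iota> x - \<iota> y)"
      using B(2)[of "x - y"] by (simp add: algebra_simps)
  qed (use B e in auto)
qed

text \<open>The Euler iterates \<open>\<iota> (p + w / n) ^ j\<close>, \<open>j \<le> n\<close>, move by \<open>O(1 / n)\<close> per step and hence
  stay in a compact part of the chart, which then contains their limit \<open>exp (D w)\<close>.\<close>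

lemma exp_in_chart:
  fixes \<iota> :: "'k::euclidean_space \<Rightarrow> real^'n^'n"
  assumes \<iota>p: "\<iota> p = mat 1" and c: "0 < c" and e0: "0 < e0"
    and lip: "\<And>x y. x \<in> cball p e0 \<Longrightarrow> y \<in> cball p e0 \<Longrightarrow> c * norm (x - y) \<le> norm (\<iota> x - \<iota> y)"
    and cont: "continuous_on (cball p e0) \<iota>"
    and der: "(\<iota> has_derivative D) (at p)"
    and mult: "0 < d" "\<And>x y. x \<in> ball p d \<Longrightarrow> y \<in> ball p d \<Longrightarrow> \<exists>z\<in>ball p e0. \<iota> z = \<iota> x ** \<iota> y"
  obtains r where "0 < r" "\<And>w. norm w \<le> r \<Longrightarrow> \<exists>y\<in>cball p e0. \<iota> y = mat_exp (D w)"
proof -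
  have D: "bounded_linear D" using der by (rule has_derivative_bounded_linear)
  then obtain L where L: "L > 0" "\<And>v. norm (D v) \<le> L * norm v"
    by (metis bounded_linear.pos_bounded mult.commute)
  define d' where "d' = min d e0"
  define \<rho> where "\<rho> = d' / 2"
  have \<rho>: "0 < \<rho>" "\<rho> < d" "\<rho> < e0" "d' \<le> d" "d' > 0"
    using mult(1) e0 by (auto simp: \<rho>_def d'_def min_def)
  have "compact (\<iota> ` cball p \<rho>)"
    using \<rho> by (intro compact_continuous_image continuous_on_subset[OF cont]) auto
  then obtain K where K: "K > 0" "\<And>x. x \<in> cball p \<rho> \<Longrightarrow> norm (\<iota> x) \<le> K"
    by (metis bounded_pos compact_imp_bounded image_eqI)
  \<comment> \<open>A step changes \<open>\<iota>\<close> by at most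
    \<open>(L + 1) * r * K / n\<close> and so moves the coordinate by at most
    \<open>\<rho> / n\<close>; hence \<open>n\<close> steps stay within \<open>\<rho>\<close> of
    \<open>p\<close>. Taking \<open>L + 1\<close> instead of \<open>L\<close> gives the strict
    inequality behind the eventual bound on \<open>\<gamma> (1 / n)\<close>.\<close>
  define r where "r = \<rho> * c / (K * (L + 1))"
  have r: "0 < r" "K * ((L + 1) * r) = c * \<rho>"
    using \<rho> c K L by (simp_all add: r_def)
  show thesis
  proof (rule that[OF r(1)])
    fix w :: 'k assume w: "norm w \<le> r"
    define \<gamma> where "\<gamma> = (\<lambda>s. \<iota> (p + s *\<^sub>R w))"
    have \<gamma>0: "\<gamma> 0 = mat 1" by (simp add: \<gamma>_def \<iota>p)
    have d\<gamma>: "(\<gamma> has_vector_derivative D w) (at 0)"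
    proof -
      have "((\<lambda>s. p + s *\<^sub>R w) has_derivative (\<lambda>s. s *\<^sub>R w)) (at 0)"
        by (auto intro!: derivative_eq_intros)
      moreover have "(\<iota> has_derivative D) (at (p + 0 *\<^sub>R w))" using der by simp
      ultimately have "(\<gamma> has_derivative (\<lambda>s. D (s *\<^sub>R w))) (at 0)"
        unfolding \<gamma>_def by (rule has_derivative_compose)
      then show ?thesis
        by (simp add: has_vector_derivative_def linear_simps[OF D])
    qed
    have "norm (D w) \<le> L * r"
      using L w by (meson mult_left_mono less_imp_le order_trans)
    then have "norm (D w) < (L + 1) * r" using r by (simp add: algebra_simps)
    from eventually_norm_diff_le[OF d\<gamma> this]
    have ev1: "\<forall>\<^sub>F n in sequentially. norm (\<gamma> (1 / real (Suc n)) - mat 1) \<le> (L + 1) * r / real (Suc n)"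
      by (simp add: \<gamma>0)
    have "(\<lambda>n. (1 / real (Suc n)) *\<^sub>R w) \<longlonglongrightarrow> 0 *\<^sub>R w"
      using LIMSEQ_inverse_real_of_nat by (intro tendsto_intros) (simp add: inverse_eq_divide)
    then have ev2: "\<forall>\<^sub>F n in sequentially. norm ((1 / real (Suc n)) *\<^sub>R w) < d"
      using mult(1) order_tendstoD(2)[OF tendsto_norm] by fastforce
    have "\<forall>\<^sub>F n in sequentially. mpow (\<gamma> (1 / real (Suc n))) (Suc n) \<in> \<iota> ` cball p \<rho>"
      using ev1 ev2
    proof eventually_elim
      case (elim n)
      let ?n = "real (Suc n)" and ?\<gamma> = "\<gamma> (1 / real (Suc n))"
      have "j \<le> Suc n \<Longrightarrow> \<exists>y\<in>cball p (\<rho> * real j / ?n). \<iota> y = mpow ?\<gamma> j" for j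
      proof (induction j)
        case 0
        then show ?case by (simp add: \<iota>p)
      next
        case (Suc j)
        then obtain y where y: "dist p y \<le> \<rho> * real j / ?n" "\<iota> y = mpow ?\<gamma> j" by auto
        have "\<rho> * real j / ?n \<le> \<rho>"
          using Suc.prems \<rho> by (simp add: divide_simps)
        then have y\<rho>: "y \<in> cball p \<rho>" using y by simp
        then have yd: "y \<in> ball p d" and ye: "y \<in> cball p e0" using \<rho> by auto
        have "p + (1 / ?n) *\<^sub>R w \<in> ball p d" using elim(2) by (simp add: dist_norm)
        \<comment> \<open>Closure under multiplication places \<open>z\<close> only in the larger
          ball; the lower Lipschitz bound then shows that it is close to \<open>y\<close>.\<close>
        then obtain z where z: "z \<in> ball p e0" "\<iota> z = ?\<gamma> ** \<iota> y"
          using mult(2)[OF _ yd] unfolding \<gamma>_def by blast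
        have "c * norm (z - y) \<le> norm (\<iota> z - \<iota> y)"
          using lip z(1) ye by simp
        also have "\<iota> z - \<iota> y = (?\<gamma> - mat 1) ** \<iota> y"
          using z(2) by (simp add: matrix_ring_simps)
        also have "norm \<dots> \<le> norm (?\<gamma> - mat 1) * norm (\<iota> y)"
          by (rule norm_matrix_mult_le)
        also have "\<dots> \<le> ((L + 1) * r / ?n) * K"
          using elim(1) K y\<rho> L r by (intro mult_mono) auto
        also have "\<dots> = c * (\<rho> / ?n)"
          using r(2) by (simp add: mult.commute)
        finally have "norm (z - y) \<le> \<rho> / ?n"
          using c by (rule mult_left_le_imp_le)
        then have "dist y z \<le> \<rho> / ?n"
          by (simp add: dist_norm norm_minus_commute)
        then have "dist p z \<le> \<rho> * real j / ?n + \<rho> / ?n"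
          using y(1) dist_triangle[of p z y] by linarith
        also have "\<dots> = \<rho> * real (Suc j) / ?n"
          by (simp add: add_divide_distrib[symmetric] algebra_simps)
        finally show ?case using z(2) y(2) by (auto simp: mpow_Suc)
      qed
      from this[of "Suc n"] obtain y where "y \<in> cball p \<rho>" "\<iota> y = mpow ?\<gamma> (Suc n)" by auto
      then show ?case by (metis imageI)
    qed
    \<comment> \<open>A compact image is closed, so it contains the limit of the iterates.\<close>
    then have "mat_exp (D w) \<in> \<iota> ` cball p \<rho>"
      using compact_imp_closed[OF \<open>compact (\<iota> ` cball p \<rho>)\<close>] mpow_tendsto_mat_exp[OF d\<gamma> \<gamma>0]
      by (intro Lim_in_closed_set[of "\<iota> ` cball p \<rho>"]) auto
    then obtain y where "y \<in> cball p \<rho>" "\<iota> y = mat_exp (D w)" by auto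
    then show "\<exists>y\<in>cball p e0. \<iota> y = mat_exp (D w)" using \<rho> by (auto intro!: bexI[of _ y])
  qed
qed

text \<open>\<open>E\<close> expresses the exponential in the chart. The lower Lipschitz bound on
  \<open>\<iota>\<close> makes \<open>E\<close> well behaved: continuous, and differentiable at
  \<open>0\<close> with the identity as derivative. This is what the open mapping theorem asks for
  that gives the covering property.\<close>

lemma exp_chart_coordinates:
  fixes \<iota> :: "'k::euclidean_space \<Rightarrow> real^'n^'n" and p :: 'k
  defines "D \<equiv> frechet_derivative \<iota> (at p)"
  assumes S: "open S" "p \<in> S" and \<iota>p: "\<iota> p = mat 1"
    and diff: "\<And>x. x \<in> S \<Longrightarrow> \<iota> differentiable (at x)"
    and cont: "\<And>v. continuous_on S (\<lambda>x. frechet_derivative \<iota> (at x) v)"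
    and inj: "inj D"
    and mult: "\<And>e. e > 0 \<Longrightarrow> \<exists>d>0. \<forall>x\<in>ball p d. \<forall>y\<in>ball p d. \<exists>z\<in>ball p e. \<iota> z = \<iota> x ** \<iota> y"
  obtains E r where "0 < r" "E 0 = p" "(E has_derivative id) (at 0)" "continuous_on (ball 0 r) E"
    "\<And>w. w \<in> ball 0 r \<Longrightarrow> E w \<in> S \<and> \<iota> (E w) = mat_exp (D w)"
    "\<And>e. 0 < e \<Longrightarrow> \<exists>d>0. ball p d \<subseteq> E ` ball 0 e"
proof -
  obtain c e0 where c: "0 < c" and e0: "0 < e0" "cball p e0 \<subseteq> S"
    and lip: "\<And>x y. x \<in> cball p e0 \<Longrightarrow> y \<in> cball p e0 \<Longrightarrow> c * norm (x - y) \<le> norm (\<iota> x - \<iota> y)"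
    using C1_immersion_lower_lipschitz[OF S diff cont inj[unfolded D_def]] by metis
  have der: "(\<iota> has_derivative D) (at p)"
    unfolding D_def using diff[OF \<open>p \<in> S\<close>] by (simp add: frechet_derivative_works)
  have D: "bounded_linear D" using der by (rule has_derivative_bounded_linear)
  have conti: "continuous_on (cball p e0) \<iota>"
    using diff e0 by (meson continuous_at_imp_continuous_on differentiable_imp_continuous_within subsetD)
  obtain d where "d > 0" "\<And>x y. x \<in> ball p d \<Longrightarrow> y \<in> ball p d \<Longrightarrow> \<exists>z\<in>ball p e0. \<iota> z = \<iota> x ** \<iota> y"
    using mult[OF e0(1)] by blast
  from exp_in_chart[OF \<iota>p c e0(1) lip conti der this]
  obtain r where r: "0 < r" "\<And>w. norm w \<le> r \<Longrightarrow> \<exists>y\<in>cball p e0. \<iota> y = mat_exp (D w)"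
    by metis
  then obtain E where E: "\<And>w. norm w \<le> r \<Longrightarrow> E w \<in> cball p e0 \<and> \<iota> (E w) = mat_exp (D w)"
    by metis
  have D0: "D 0 = 0" using D by (rule linear_simps)
  have E0: "E 0 = p"
    using lip[of "E 0" p] E[of 0] e0 r(1) c by (simp add: \<iota>p D0 mult_le_0_iff)
  have contexp: "continuous_on (ball 0 r) (\<lambda>w. mat_exp (D w))"
    by (intro continuous_on_compose2[OF continuous_on_mat_exp[of UNIV]] linear_continuous_on D) auto
  have contE: "continuous_on (ball 0 r) E"
    unfolding continuous_on_iff
  proof (intro ballI allI impI)
    fix w :: 'k and \<epsilon> :: real assume w: "w \<in> ball 0 r" and "\<epsilon> > 0"
    then have "c * \<epsilon> > 0" using c by simp
    from contexp[unfolded continuous_on_iff, rule_format, OF w this]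
    obtain \<eta> where \<eta>: "\<eta> > 0"
      "\<And>w'. w' \<in> ball 0 r \<Longrightarrow> dist w' w < \<eta> \<Longrightarrow> dist (mat_exp (D w')) (mat_exp (D w)) < c * \<epsilon>"
      by blast
    have "dist (E w') (E w) < \<epsilon>" if "w' \<in> ball 0 r" "dist w' w < \<eta>" for w'
    proof -
      have "c * norm (E w' - E w) \<le> norm (mat_exp (D w') - mat_exp (D w))"
        using lip[of "E w'" "E w"] E[of w] E[of w'] w that by simp
      also have "\<dots> < c * \<epsilon>" using \<eta>(2)[OF that] by (simp add: dist_norm)
      finally show ?thesis using c by (simp add: dist_norm)
    qed
    then show "\<exists>\<eta>>0. \<forall>w'\<in>ball 0 r. dist w' w < \<eta> \<longrightarrow> dist (E w') (E w) < \<epsilon>"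
      using \<eta>(1) by blast
  qed
  \<comment> \<open>Both terms have derivative \<open>D\<close> at \<open>0\<close>, so
    \<open>?F\<close> is of smaller order than \<open>norm w\<close>. The lower Lipschitz bound
    passes this on to \<open>E w - (p + w)\<close>.\<close>
  let ?F = "\<lambda>w. mat_exp (D w) - \<iota> (p + w)"
  have dF: "(?F has_derivative (\<lambda>w. 0)) (at 0)"
  proof -
    have 1: "((\<lambda>w. mat_exp (D w)) has_derivative D) (at 0)"
      using has_derivative_compose[OF bounded_linear_imp_has_derivative[OF D], of mat_exp "\<lambda>X. X" 0]
        mat_exp_has_derivative_0 by (simp add: D0)
    have "((\<lambda>w. p + w) has_derivative (\<lambda>w. w)) (at 0)"
      by (auto intro!: derivative_eq_intros)
    then have 2: "((\<lambda>w. \<iota> (p + w)) has_derivative D) (at 0)"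
      by (rule has_derivative_compose) (use der in simp)
    show ?thesis using has_derivative_diff[OF 1 2] by simp
  qed
  have F0: "?F 0 = 0" by (simp add: D0 \<iota>p)
  have dE: "(E has_derivative id) (at 0)"
  proof (rule has_derivativeI_sandwich[where e = "min r e0" and H = "\<lambda>w. (1 / c) * (norm (?F w) / norm w)"])
    show "bounded_linear (id :: 'k \<Rightarrow> 'k)" by (simp add: id_def bounded_linear_ident)
    have "((\<lambda>w. norm (?F w) / norm w) \<longlongrightarrow> 0) (at 0)"
      using dF F0 unfolding has_derivative_iff_norm by simp
    then show "((\<lambda>w. (1 / c) * (norm (?F w) / norm w)) \<longlongrightarrow> 0) (at 0)"
      by (rule tendsto_mult_right_zero)
  next
    fix w :: 'k assume w: "w \<noteq> 0" "dist w 0 < min r e0"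
    then have "c * norm (E w - (p + w)) \<le> norm (?F w)"
      using lip[of "E w" "p + w"] E[of w] by (simp add: dist_norm)
    then have "norm (E w - (p + w)) \<le> (1 / c) * norm (?F w)"
      using c by (simp add: field_simps)
    then show "norm (E w - E 0 - id (w - 0)) / norm (w - 0) \<le> (1 / c) * (norm (?F w) / norm w)"
      using divide_right_mono[OF _ norm_ge_zero, of _ _ w] by (fastforce simp: E0 diff_diff_eq)
  qed (use r e0 in auto)
  have cover: "\<exists>d>0. ball p d \<subseteq> E ` ball 0 e" if "0 < e" for e
  proof -
    have "E 0 \<in> interior (E ` (ball 0 r \<inter> ball 0 e))"
      by (rule sussmann_open_mapping[OF open_ball contE _ dE, where g' = id])
        (use that r in \<open>auto simp: id_def bounded_linear_ident interior_open open_Int\<close>)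
    then obtain d where "d > 0" "ball p d \<subseteq> E ` (ball 0 r \<inter> ball 0 e)"
      unfolding mem_interior E0 by blast
    then show ?thesis by blast
  qed
  show thesis
    by (rule that[OF r(1) E0 dE contE _ cover]) (use E e0 in fastforce)
qed

section \<open>Lie subgroups near the identity\<close>

lemma matrix_inv_mult:
  fixes X :: "real^'n^'n"
  assumes "invertible X"
  shows "X ** matrix_inv X = mat 1" "matrix_inv X ** X = mat 1"
proof -
  have "X ** matrix_inv X = mat 1 \<and> matrix_inv X ** X = mat 1"
    using assms unfolding invertible_def matrix_inv_def by (rule someI_ex)
  then show "X ** matrix_inv X = mat 1" "matrix_inv X ** X = mat 1" by auto
qed

lemma matrix_inv_eqI:
  fixes X Y :: "real^'n^'n"
  assumes "X ** Y = mat 1"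
  shows "matrix_inv X = Y"
proof -
  have "Y ** X = mat 1" using assms matrix_left_right_inverse by blast
  then have "invertible X" using assms invertible_def by blast
  then have "matrix_inv X ** X = mat 1" by (rule matrix_inv_mult)
  then show ?thesis
    using assms by (metis matrix_mul_assoc matrix_mul_lid matrix_mul_rid)
qed

lemma matrix_inv_one [simp]: "matrix_inv (mat 1 :: real^'n^'n) = mat 1"
  by (rule matrix_inv_eqI) simp

lemma matrix_inv_matrix_inv: "invertible X \<Longrightarrow> matrix_inv (matrix_inv X) = X"
  for X :: "real^'n^'n"
  by (rule matrix_inv_eqI) (rule matrix_inv_mult)

lemma invertible_if_ker_trivial:
  fixes X :: "real^'n^'n"
  assumes "\<And>v. X *v v = 0 \<Longrightarrow> v = 0"
  shows "invertible X"
  using assms by (simp add: invertible_left_inverse matrix_left_invertible_ker)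

section \<open>The Lie subgroup in a chart at the identity\<close>

locale lie_chart =
  fixes \<Gamma> :: "(real^'n^'n) set"
    and T :: "(real^'n^'n) topology"
    and \<A> :: "(real^'n^'n, 'k::euclidean_space) atlas"
    and U :: "(real^'n^'n) set"
    and \<phi> :: "real^'n^'n \<Rightarrow> 'k"
  assumes lie: "lie_subgroup \<Gamma> T \<A>"
    and chart: "(U, \<phi>) \<in> \<A>"
    and one_in_U: "mat 1 \<in> U"
begin

text \<open>\<open>\<iota>\<close> is the inclusion of the group into the matrices, read in the
  chart; \<open>D\<close> is its differential at the identity, a linear parametrization of the Lie
  algebra.\<close>

abbreviation "\<iota> \<equiv> inv_into U \<phi>"
abbreviation "p \<equiv> \<phi> (mat 1)"
definition "D = frechet_derivative \<iota> (at p)"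

lemma manifold: "smooth_manifold T \<A>"
  and topspace_T: "topspace T = \<Gamma>"
  and subgroup_\<Gamma>: "subgroup \<Gamma> GL"
  and cont_mult: "continuous_map (prod_topology T T) T (\<lambda>(M, N). M ** N)"
  and cont_inv: "continuous_map T T matrix_inv"
  and smooth_inv: "smooth_map T \<A> T \<A> matrix_inv"
  and smooth_inclusion: "smooth_map T \<A> euclidean euclidean_atlas (\<lambda>M. M)"
  and inj_D: "inj D"
  using lie chart one_in_U by (auto simp: lie_subgroup_def smooth_map_def D_def)

lemma openin_U: "openin T U"
  and open_image_U: "open (\<phi> ` U)"
  and homeo: "homeomorphic_map (subtopology T U) (top_of_set (\<phi> ` U)) \<phi>"
  using manifold chart by (auto simp: smooth_manifold_def)

lemma U_subset: "U \<subseteq> \<Gamma>"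
  using openin_subset[OF openin_U] topspace_T by simp

lemma inj_on_\<phi>: "inj_on \<phi> U"
  using homeomorphic_imp_injective_map[OF homeo] U_subset topspace_T
  by (simp add: Int_absorb1)

lemma \<iota>_\<phi> [simp]: "M \<in> U \<Longrightarrow> \<iota> (\<phi> M) = M"
  by (rule inv_into_f_f[OF inj_on_\<phi>])

lemma open_image: "openin T W \<Longrightarrow> W \<subseteq> U \<Longrightarrow> open (\<phi> ` W)"
  using homeomorphic_imp_open_map[OF homeo] openin_open_trans[OF _ open_image_U]
  by (auto simp: open_map_def openin_open_subtopology[OF openin_U])

lemma openin_preimage: "open V \<Longrightarrow> openin T {M \<in> U. \<phi> M \<in> V}"
proof -
  assume "open V"
  then have "openin (top_of_set (\<phi> ` U)) (\<phi> ` U \<inter> V)" by auto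
  note openin_continuous_map_preimage[OF homeomorphic_imp_continuous_map[OF homeo] this]
  moreover have "{M \<in> topspace (subtopology T U). \<phi> M \<in> \<phi> ` U \<inter> V} = {M \<in> U. \<phi> M \<in> V}"
    using U_subset topspace_T by auto
  ultimately show ?thesis
    by (simp add: openin_open_subtopology[OF openin_U])
qed

lemma smooth_\<iota>:
  "x \<in> \<phi> ` U \<Longrightarrow> \<iota> differentiable (at x)"
  "continuous_on (\<phi> ` U) (\<lambda>x. frechet_derivative \<iota> (at x) v)"
proof -
  have "smooth_on (\<phi> ` U) (id \<circ> (\<lambda>M. M) \<circ> \<iota>)"
    using smooth_inclusion chart by (auto simp: smooth_map_def euclidean_atlas_def)
  then have "ck_on (Suc 0) (\<phi> ` U) \<iota>"
    unfolding smooth_on_def by (simp only: o_def id_def)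
  then show "x \<in> \<phi> ` U \<Longrightarrow> \<iota> differentiable (at x)"
    "continuous_on (\<phi> ` U) (\<lambda>x. frechet_derivative \<iota> (at x) v)" by auto
qed

lemma has_derivative_\<iota>: "(\<iota> has_derivative D) (at p)"
  unfolding D_def using smooth_\<iota>(1)[of p] one_in_U by (simp add: frechet_derivative_works)

lemma bounded_linear_D: "bounded_linear D"
  using has_derivative_\<iota> by (rule has_derivative_bounded_linear)

lemma one_in: "mat 1 \<in> \<Gamma>"
  using one_in_U U_subset by auto

lemma invertible_\<Gamma>: "M \<in> \<Gamma> \<Longrightarrow> invertible M"
  using subgroup.subset[OF subgroup_\<Gamma>] by (auto simp: GL_def)

lemma mult_in: "M \<in> \<Gamma> \<Longrightarrow> N \<in> \<Gamma> \<Longrightarrow> M ** N \<in> \<Gamma>"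
  using subgroup.m_closed[OF subgroup_\<Gamma>] by (simp add: GL_def)

lemma inv_in: "M \<in> \<Gamma> \<Longrightarrow> matrix_inv M \<in> \<Gamma>"
  using cont_inv topspace_T by (auto simp: continuous_map_def)

text \<open>Open sets refer to the manifold topology \<open>T\<close>, which may be finer than that
  of the matrices; hence the continuity used is that of the group operation of
  \<open>\<Gamma>\<close>.\<close>

lemma mult_nhd:
  assumes "openin T W" "mat 1 \<in> W"
  obtains W' where "openin T W'" "mat 1 \<in> W'" "\<And>M N. M \<in> W' \<Longrightarrow> N \<in> W' \<Longrightarrow> M ** N \<in> W"
proof -
  define P where "P = {q \<in> topspace (prod_topology T T). (\<lambda>(M, N). M ** N) q \<in> W}"
  have "openin (prod_topology T T) P"
    unfolding P_def by (rule openin_continuous_map_preimage[OF cont_mult assms(1)])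
  moreover have "(mat 1, mat 1) \<in> P"
    using assms one_in by (simp add: P_def topspace_T)
  ultimately obtain W1 W2 where W12: "openin T W1" "openin T W2" "mat 1 \<in> W1" "mat 1 \<in> W2" "W1 \<times> W2 \<subseteq> P"
    using openin_prod_topology_alt[THEN iffD1, rule_format] by metis
  have "M ** N \<in> W" if "M \<in> W1 \<inter> W2" "N \<in> W1 \<inter> W2" for M N
    using subsetD[OF W12(5), of "(M, N)"] that by (simp add: P_def)
  then show thesis
    using W12 by (intro that[of "W1 \<inter> W2"]) auto
qed

lemma inv_nhd:
  assumes "openin T W" "mat 1 \<in> W"
  obtains W' where "openin T W'" "mat 1 \<in> W'" "\<And>M. M \<in> W' \<Longrightarrow> matrix_inv M \<in> W"
  using openin_continuous_map_preimage[OF cont_inv assms(1)] assms(2) one_in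
  by (intro that[of "{M \<in> topspace T. matrix_inv M \<in> W}"]) (auto simp: topspace_T)

text \<open>The change of charts is differentiable, so the chain rule factors the differential of
  one inverse chart through that of the other. Hence \<open>lie_algebra_of\<close>, a union over all
  charts at the identity, is the single subspace \<open>range D\<close>.\<close>

lemma range_derivative_subset:
  assumes "(V, \<psi>) \<in> \<A>" "mat 1 \<in> V"
  shows "range (frechet_derivative (inv_into V \<psi>) (at (\<psi> (mat 1)))) \<subseteq> range D"
proof -
  interpret V: lie_chart \<Gamma> T \<A> V \<psi>
    by (rule lie_chart.intro[OF lie assms])
  let ?\<tau> = "\<phi> \<circ> inv_into V \<psi>"
  have "smooth_on (\<psi> ` (V \<inter> U)) ?\<tau>"
    using manifold chart assms(1) by (fastforce simp: smooth_manifold_def)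
  then have "ck_on (Suc 0) (\<psi> ` (V \<inter> U)) ?\<tau>"
    unfolding smooth_on_def by blast
  then have "?\<tau> differentiable (at (\<psi> (mat 1)))"
    using one_in_U assms(2) by auto
  then obtain \<tau>' where "(?\<tau> has_derivative \<tau>') (at (\<psi> (mat 1)))"
    unfolding differentiable_def by blast
  moreover have "(\<iota> has_derivative D) (at (?\<tau> (\<psi> (mat 1))))"
    using has_derivative_\<iota> assms(2) by simp
  ultimately have "((\<iota> \<circ> ?\<tau>) has_derivative (D \<circ> \<tau>')) (at (\<psi> (mat 1)))"
    by (rule diff_chain_at)
  moreover have "open (\<psi> ` (V \<inter> U))"
    using openin_U V.openin_U by (intro V.open_image) auto
  moreover have "\<psi> (mat 1) \<in> \<psi> ` (V \<inter> U)"
    using one_in_U assms(2) by auto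
  moreover have "(\<iota> \<circ> ?\<tau>) x = inv_into V \<psi> x" if "x \<in> \<psi> ` (V \<inter> U)" for x
    using that by auto
  ultimately have "(inv_into V \<psi> has_derivative (D \<circ> \<tau>')) (at (\<psi> (mat 1)))"
    by (rule has_derivative_transform_within_open)
  then have "frechet_derivative (inv_into V \<psi>) (at (\<psi> (mat 1))) = D \<circ> \<tau>'"
    by (rule frechet_derivative_at[symmetric])
  then show ?thesis by auto
qed

lemma lie_algebra_eq: "lie_algebra_of \<A> = range D"
  using range_derivative_subset chart one_in_U unfolding lie_algebra_of_def D_def by fast

text \<open>Transfers \<open>exp_chart_coordinates\<close> from the chart to \<open>T\<close>. The
  last two clauses say that the exponential is continuous at \<open>0\<close> into \<open>T\<close>,
  and that its values on small balls contain neighbourhoods of the identity in \<open>T\<close>; the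
  second of these supplies logarithms.\<close>

lemma exp_chart:
  obtains E where "E 0 = p" "(E has_derivative id) (at 0)"
    "\<forall>\<^sub>F w in nhds 0. E w \<in> \<phi> ` U \<and> \<iota> (E w) = mat_exp (D w)"
    "\<And>W. openin T W \<Longrightarrow> mat 1 \<in> W \<Longrightarrow> \<forall>\<^sub>F w in nhds 0. mat_exp (D w) \<in> W"
    "\<And>e. 0 < e \<Longrightarrow> \<exists>W. openin T W \<and> mat 1 \<in> W \<and> W \<subseteq> (\<lambda>w. mat_exp (D w)) ` ball 0 e"
proof -
  have mult: "\<exists>d>0. \<forall>x\<in>ball p d. \<forall>y\<in>ball p d. \<exists>z\<in>ball p e. \<iota> z = \<iota> x ** \<iota> y" if "e > 0" for e
  proof -
    let ?W = "{M \<in> U. \<phi> M \<in> ball p e}"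
    have 1: "openin T ?W" by (rule openin_preimage) simp
    have 2: "mat 1 \<in> ?W" using one_in_U that by simp
    obtain W' where W': "openin T W'" "mat 1 \<in> W'" "\<And>M N. M \<in> W' \<Longrightarrow> N \<in> W' \<Longrightarrow> M ** N \<in> ?W"
      using mult_nhd[OF 1 2] by blast
    have "open (\<phi> ` (W' \<inter> U))"
      using W' openin_U by (intro open_image) auto
    then obtain d where d: "d > 0" "ball p d \<subseteq> \<phi> ` (W' \<inter> U)"
      using W'(2) one_in_U by (metis IntI imageI open_contains_ball)
    have "\<exists>z\<in>ball p e. \<iota> z = \<iota> x ** \<iota> y" if xy: "x \<in> ball p d" "y \<in> ball p d" for x y
    proof -
      obtain M N where MN: "M \<in> W' \<inter> U" "N \<in> W' \<inter> U" "x = \<phi> M" "y = \<phi> N"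
        using xy d(2) by blast
      then have "M ** N \<in> ?W" using W'(3) by blast
      then show ?thesis using MN by (intro bexI[of _ "\<phi> (M ** N)"]) auto
    qed
    then show ?thesis using d(1) by blast
  qed
  obtain E r where r: "0 < r" and E: "E 0 = p" "(E has_derivative id) (at 0)" "continuous_on (ball 0 r) E"
    "\<And>w. w \<in> ball 0 r \<Longrightarrow> E w \<in> \<phi> ` U \<and> \<iota> (E w) = mat_exp (D w)"
    and cover: "\<And>e. 0 < e \<Longrightarrow> \<exists>d>0. ball p d \<subseteq> E ` ball 0 e"
    using exp_chart_coordinates[OF open_image_U imageI[OF one_in_U], of \<iota>, folded D_def,
        OF \<iota>_\<phi>[OF one_in_U] smooth_\<iota> inj_D mult] by metis
  have ev: "\<forall>\<^sub>F w in nhds 0. E w \<in> \<phi> ` U \<and> \<iota> (E w) = mat_exp (D w)"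
    using eventually_nhds_in_open[OF open_ball, of 0 0 r] r E(4)
    by (auto elim: eventually_mono)
  show thesis
  proof (rule that[OF E(1,2) ev])
    fix W assume W: "openin T W" "mat 1 \<in> W"
    have "open (\<phi> ` (W \<inter> U))"
      using W openin_U by (intro open_image) auto
    moreover have "(E \<longlongrightarrow> p) (nhds 0)"
      using has_derivative_continuous[OF E(2)] unfolding isCont_def E(1)
      by (metis E(1) tendsto_at_iff_tendsto_nhds)
    ultimately have "\<forall>\<^sub>F w in nhds 0. E w \<in> \<phi> ` (W \<inter> U)"
      using W one_in_U by (intro topological_tendstoD) auto
    then show "\<forall>\<^sub>F w in nhds 0. mat_exp (D w) \<in> W"
      using ev by eventually_elim auto
  next
    fix e :: real assume "0 < e"
    then obtain d where d: "d > 0" "ball p d \<subseteq> E ` ball 0 (min e r)"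
      using cover[of "min e r"] r by auto
    let ?W = "{M \<in> U. \<phi> M \<in> ball p d}"
    have "openin T ?W" by (rule openin_preimage) simp
    moreover have "mat 1 \<in> ?W" using one_in_U d(1) by simp
    moreover have "?W \<subseteq> (\<lambda>w. mat_exp (D w)) ` ball 0 e"
    proof
      fix M assume M: "M \<in> ?W"
      then obtain w where w: "w \<in> ball 0 (min e r)" "\<phi> M = E w" using d(2) by blast
      then have "M = \<iota> (E w)" using M by (metis (no_types, lifting) \<iota>_\<phi> mem_Collect_eq)
      then show "M \<in> (\<lambda>w. mat_exp (D w)) ` ball 0 e"
        using w(1) E(4)[of w] by auto
    qed
    ultimately show "\<exists>W. openin T W \<and> mat 1 \<in> W \<and> W \<subseteq> (\<lambda>w. mat_exp (D w)) ` ball 0 e" by blast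
  qed
qed

end

section \<open>Differentiability of the endomorphism\<close>

text \<open>The entries of \<open>G x\<close> are the coordinates of the vectors
  \<open>G x *v axis j 1\<close>.\<close>

lemma matrix_differentiableI:
  fixes G :: "'k::euclidean_space \<Rightarrow> real^'n^'m"
  assumes "\<And>u. (\<lambda>x. G x *v u) differentiable (at p)"
  shows "G differentiable (at p)"
proof -
  have "(\<lambda>x. G x \<bullet> b) differentiable (at p)" if "b \<in> Basis" for b
  proof -
    from that obtain i j where b: "b = axis i (axis j 1)"
      by (auto simp: Basis_vec_def)
    have "G x \<bullet> b = (G x *v axis j 1) \<bullet> axis i 1" for x
      by (simp add: b inner_axis matrix_vector_mult_basis column_def)
    then show ?thesis
      using assms[of "axis j 1"] by (simp add: differentiable_inner)
  qed
  then show ?thesis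
    by (subst differentiable_componentwise_within) blast
qed

locale xi_loop = lie_chart \<Gamma> T \<A> U \<phi>
  for \<Gamma> :: "(real^'n^'n) set" and T and \<A> :: "(real^'n^'n, 'k::euclidean_space) atlas" and U \<phi> +
  fixes \<delta> :: "real^'n^'n \<Rightarrow> real^'n^'n"
    and A B :: "real^'n^'n"
  assumes hom: "\<delta> \<in> hom (GL\<lparr>carrier := \<Gamma>\<rparr>) (GL\<lparr>carrier := \<Gamma>\<rparr>)"
    and B: "B \<in> carrier GL"
    and eig: "\<And>M. M \<in> \<Gamma> \<Longrightarrow> \<not> mat_eigenvalue (matrix_inv M ** matrix_inv B ** \<delta> M ** A) 1"
    and loop: "smooth_loop (prod_topology euclidean T) (prod_atlas euclidean_atlas \<A>)
           (xi_mult A B \<delta>) (0, mat 1)"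
begin

lemma \<delta>_in: "M \<in> \<Gamma> \<Longrightarrow> \<delta> M \<in> \<Gamma>"
  and \<delta>_mult: "M \<in> \<Gamma> \<Longrightarrow> N \<in> \<Gamma> \<Longrightarrow> \<delta> (M ** N) = \<delta> M ** \<delta> N"
  using hom by (auto simp: hom_def GL_def)

lemma \<delta>_one: "\<delta> (mat 1) = mat 1"
proof -
  have "\<delta> (mat 1) ** \<delta> (mat 1) = \<delta> (mat 1)"
    using \<delta>_mult[OF one_in one_in] by simp
  then show ?thesis
    using matrix_inv_mult(2)[OF invertible_\<Gamma>[OF \<delta>_in[OF one_in]]]
    by (metis matrix_mul_assoc matrix_mul_lid)
qed

lemma \<delta>_inv: "M \<in> \<Gamma> \<Longrightarrow> \<delta> M ** \<delta> (matrix_inv M) = mat 1"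
  using \<delta>_mult[of M "matrix_inv M"] inv_in \<delta>_one matrix_inv_mult(1)[OF invertible_\<Gamma>] by simp

definition P where "P M = B - \<delta> M ** A ** matrix_inv M"

definition Q where "Q M N = matrix_inv (P (M ** N)) ** \<delta> M ** P N"

lemma xi_mult_eq: "xi_mult A B \<delta> (u, M) (v, N) = (u + Q M N *v v, M ** N)"
  by (simp add: xi_mult_def P_def Q_def)

lemma invertible_B: "invertible B"
  using B by (simp add: GL_def)

lemma P_one: "P (mat 1) = B - A"
  by (simp add: P_def \<delta>_one)

text \<open>If \<open>P M *v v = 0\<close>, then \<open>matrix_inv M *v v\<close> is fixed by the
  matrix of the eigenvalue condition and is therefore zero.\<close>

lemma invertible_P:
  assumes "M \<in> \<Gamma>"
  shows "invertible (P M)"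
proof (rule invertible_if_ker_trivial)
  fix v assume "P M *v v = 0"
  then have v: "(\<delta> M ** A ** matrix_inv M) *v v = B *v v"
    by (simp add: P_def matrix_vector_mult_diff_rdistrib)
  let ?w = "matrix_inv M *v v"
  have "(matrix_inv M ** matrix_inv B ** \<delta> M ** A) *v ?w
      = (matrix_inv M ** matrix_inv B) *v ((\<delta> M ** A ** matrix_inv M) *v v)"
    by (simp add: matrix_vector_mul_assoc matrix_mul_assoc)
  also have "\<dots> = (matrix_inv M ** (matrix_inv B ** B)) *v v"
    unfolding v by (simp add: matrix_vector_mul_assoc matrix_mul_assoc)
  also have "\<dots> = 1 *\<^sub>R ?w"
    by (simp add: matrix_inv_mult(2)[OF invertible_B])
  finally have "?w = 0"
    using eig[OF assms] unfolding mat_eigenvalue_def by blast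
  then have "M *v ?w = 0" by simp
  then show "v = 0"
    by (simp add: matrix_vector_mul_assoc matrix_inv_mult(1)[OF invertible_\<Gamma>[OF assms]])
qed

text \<open>For \<open>N = matrix_inv M\<close> the factor \<open>P (M ** N)\<close> is the constant
  \<open>B - A\<close>, and \<open>\<delta> M ** P N\<close> becomes
  \<open>\<delta> M ** B - A ** M\<close>, which can be solved for
  \<open>\<delta> M\<close>.\<close>

lemma \<delta>_eq:
  assumes "M \<in> \<Gamma>"
  shows "\<delta> M = ((B - A) ** Q M (matrix_inv M) + A ** M) ** matrix_inv B"
proof -
  have iM: "invertible M" using assms by (rule invertible_\<Gamma>)
  have P1: "(B - A) ** matrix_inv (B - A) = mat 1"
    using matrix_inv_mult(1)[OF invertible_P[OF one_in]] by (simp add: P_one)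
  have "\<delta> M ** P (matrix_inv M) = \<delta> M ** B - (\<delta> M ** \<delta> (matrix_inv M)) ** A ** M"
    by (simp add: P_def matrix_ring_simps matrix_inv_matrix_inv[OF iM])
  then have "(B - A) ** Q M (matrix_inv M) = \<delta> M ** B - A ** M"
    using matrix_inv_mult(1)[OF iM] \<delta>_inv[OF assms]
    by (metis (no_types, lifting) P1 P_one Q_def matrix_mul_assoc matrix_mul_lid)
  then have "(B - A) ** Q M (matrix_inv M) + A ** M = \<delta> M ** B" by simp
  then show ?thesis
    using matrix_inv_mult(1)[OF invertible_B] by (metis matrix_mul_assoc matrix_mul_rid)
qed

text \<open>The vector is the first component of the loop product of \<open>(0, M)\<close> and
  \<open>(u, matrix_inv M)\<close> with \<open>M = \<iota> x\<close>. In charts it is the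
  multiplication composed with a map that is differentiable at \<open>p\<close>.\<close>

lemma differentiable_Q:
  "(\<lambda>x. Q (\<iota> x) (matrix_inv (\<iota> x)) *v u) differentiable (at p)"
proof -
  let ?L = "prod_topology euclidean T" and ?\<L> = "prod_atlas euclidean_atlas \<A>"
  let ?U = "(UNIV :: (real^'n) set) \<times> U" and ?\<phi> = "map_prod (id :: real^'n \<Rightarrow> _) \<phi>"
  let ?f = "\<lambda>(a, b). xi_mult A B \<delta> a b"
  let ?S = "map_prod ?\<phi> ?\<phi> ` {q \<in> ?U \<times> ?U. ?f q \<in> ?U}"
  let ?F = "?\<phi> \<circ> ?f \<circ> inv_into (?U \<times> ?U) (map_prod ?\<phi> ?\<phi>)"
  \<comment> \<open>\<open>?R\<close> consists of the coordinates of those \<open>M\<close> for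
    which \<open>M\<close> and its inverse both lie in the chart domain. Their product is
    \<open>mat 1\<close>, so all chart conditions behind \<open>?S\<close> hold.\<close>
  let ?R = "\<phi> ` {M \<in> U. matrix_inv M \<in> U}"
  let ?h = "\<lambda>x. ((0 :: real^'n, x), (u, \<phi> (matrix_inv (\<iota> x))))"
  have inj: "inj_on (map_prod ?\<phi> ?\<phi>) (?U \<times> ?U)"
    by (intro map_prod_inj_on inj_on_id inj_on_\<phi>)
  have "(?U, ?\<phi>) \<in> ?\<L>"
    using chart by (auto simp: prod_atlas_def euclidean_atlas_def)
  moreover from this have "(?U \<times> ?U, map_prod ?\<phi> ?\<phi>) \<in> prod_atlas ?\<L> ?\<L>"
    unfolding prod_atlas_def[of ?\<L>] by blast
  moreover have "differentiable_map (prod_topology ?L ?L) (prod_atlas ?\<L> ?\<L>) ?L ?\<L> ?f"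
    using loop by (simp add: smooth_loop_def)
  ultimately have F: "?F differentiable_on ?S"
    unfolding differentiable_map_def by blast
  have R: "open ?R"
    by (intro open_image openin_continuous_map_preimage_gen[OF cont_inv openin_U openin_U]) auto
  have pR: "p \<in> ?R" using one_in_U by auto
  have "smooth_on ?R (\<phi> \<circ> matrix_inv \<circ> \<iota>)"
    using smooth_inv chart unfolding smooth_map_def by blast
  then have "ck_on (Suc 0) ?R (\<phi> \<circ> matrix_inv \<circ> \<iota>)"
    unfolding smooth_on_def by blast
  then have "(\<phi> \<circ> matrix_inv \<circ> \<iota>) differentiable (at p)"
    using pR unfolding ck_on.simps by blast
  then obtain g' where "((\<phi> \<circ> matrix_inv \<circ> \<iota>) has_derivative g') (at p)"
    unfolding differentiable_def by blast
  then have "(?h has_derivative (\<lambda>v. ((0, v), (0, g' v)))) (at p within ?R)"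
    by (intro has_derivative_Pair has_derivative_const has_derivative_ident)
      (simp add: o_def has_derivative_at_withinI)
  then have h: "?h differentiable (at p within ?R)"
    unfolding differentiable_def by blast
  have key: "?h x = map_prod ?\<phi> ?\<phi> ((0, \<iota> x), (u, matrix_inv (\<iota> x)))"
    "((0, \<iota> x), (u, matrix_inv (\<iota> x))) \<in> {q \<in> ?U \<times> ?U. ?f q \<in> ?U}"
    "\<iota> x ** matrix_inv (\<iota> x) = mat 1" if "x \<in> ?R" for x
  proof -
    from that obtain M where M: "x = \<phi> M" "M \<in> U" "matrix_inv M \<in> U" by auto
    have "M ** matrix_inv M = mat 1"
      using M U_subset by (intro matrix_inv_mult invertible_\<Gamma>) auto
    with M show "?h x = map_prod ?\<phi> ?\<phi> ((0, \<iota> x), (u, matrix_inv (\<iota> x)))"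
      "((0, \<iota> x), (u, matrix_inv (\<iota> x))) \<in> {q \<in> ?U \<times> ?U. ?f q \<in> ?U}"
      "\<iota> x ** matrix_inv (\<iota> x) = mat 1"
      using one_in_U by (auto simp: xi_mult_eq)
  qed
  have sub: "?h ` ?R \<subseteq> ?S"
  proof
    fix y assume "y \<in> ?h ` ?R"
    then obtain x where x: "x \<in> ?R" "y = ?h x" by blast
    show "y \<in> ?S"
      unfolding x(2) key(1)[OF x(1)] by (rule imageI[OF key(2)[OF x(1)]])
  qed
  \<comment> \<open>\<open>differentiable_on\<close> speaks of derivatives within \<open>?S\<close>,
    so the chain rule is applied within subsets; openness of \<open>?R\<close> removes the
    restriction afterwards.\<close>
  have "?F differentiable (at (?h p) within ?h ` ?R)"
    using F sub pR by (meson differentiable_on_def differentiable_within_subset imageI subsetD)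
  then have "(?F \<circ> ?h) differentiable (at p within ?R)"
    by (rule differentiable_chain_within[OF h])
  then obtain G where "((?F \<circ> ?h) has_derivative G) (at p within ?R)"
    unfolding differentiable_def by blast
  then have "((?F \<circ> ?h) has_derivative G) (at p)"
    by (simp only: at_within_open[OF pR R])
  then have "((\<lambda>x. fst ((?F \<circ> ?h) x)) has_derivative (\<lambda>v. fst (G v))) (at p)"
    by (rule bounded_linear.has_derivative[OF bounded_linear_fst])
  then have "((\<lambda>x. Q (\<iota> x) (matrix_inv (\<iota> x)) *v u) has_derivative (\<lambda>v. fst (G v))) (at p)"
  proof (rule has_derivative_transform_within_open[OF _ R pR])
    fix x assume x: "x \<in> ?R"
    have "inv_into (?U \<times> ?U) (map_prod ?\<phi> ?\<phi>) (?h x) = ((0, \<iota> x), (u, matrix_inv (\<iota> x)))"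
      unfolding key(1)[OF x] using key(2)[OF x] by (intro inv_into_f_f[OF inj]) blast
    then show "fst ((?F \<circ> ?h) x) = Q (\<iota> x) (matrix_inv (\<iota> x)) *v u"
      by (simp add: xi_mult_eq)
  qed
  then show ?thesis unfolding differentiable_def by blast
qed

lemma differentiable_\<delta>: "(\<lambda>x. \<delta> (\<iota> x)) differentiable (at p)"
proof -
  obtain G' where G': "((\<lambda>x. Q (\<iota> x) (matrix_inv (\<iota> x))) has_derivative G') (at p)"
    using matrix_differentiableI[OF differentiable_Q] unfolding differentiable_def by blast
  have "((\<lambda>x. ((B - A) ** Q (\<iota> x) (matrix_inv (\<iota> x)) + A ** \<iota> x) ** matrix_inv B)
      has_derivative (\<lambda>v. ((B - A) ** G' v + A ** D v) ** matrix_inv B)) (at p)"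
    by (intro bounded_linear.has_derivative[OF mm.bounded_linear_left] has_derivative_add
        bounded_linear.has_derivative[OF mm.bounded_linear_right] G' has_derivative_\<iota>)
  then have "((\<lambda>x. \<delta> (\<iota> x)) has_derivative (\<lambda>v. ((B - A) ** G' v + A ** D v) ** matrix_inv B)) (at p)"
  proof (rule has_derivative_transform_within_open[OF _ open_image_U])
    fix x assume "x \<in> \<phi> ` U"
    then have "\<iota> x \<in> \<Gamma>" using U_subset by auto
    then show "((B - A) ** Q (\<iota> x) (matrix_inv (\<iota> x)) + A ** \<iota> x) ** matrix_inv B = \<delta> (\<iota> x)"
      by (rule \<delta>_eq[symmetric])
  qed (use one_in_U in auto)
  then show ?thesis unfolding differentiable_def by blast
qed

text \<open>Near \<open>0\<close> the exponential is \<open>\<iota> (E w)\<close>, so this is the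
  chain rule with \<open>E\<close>, whose derivative at \<open>0\<close> is the identity.\<close>

lemma \<delta>_exp_has_derivative:
  obtains D' where "((\<lambda>w. \<delta> (mat_exp (D w))) has_derivative D') (at 0)"
proof -
  obtain E where E: "E 0 = p" "(E has_derivative id) (at 0)"
    "\<forall>\<^sub>F w in nhds 0. E w \<in> \<phi> ` U \<and> \<iota> (E w) = mat_exp (D w)"
    by (rule exp_chart) (rule that)
  obtain D' where D': "((\<lambda>x. \<delta> (\<iota> x)) has_derivative D') (at p)"
    using differentiable_\<delta> unfolding differentiable_def by blast
  have dE: "((\<lambda>w. \<delta> (\<iota> (E w))) has_derivative (\<lambda>w. D' (id w))) (at 0)"
    by (rule has_derivative_compose[OF E(2)]) (use D' E(1) in simp)
  obtain N where N: "open N" "0 \<in> N" "\<And>w. w \<in> N \<Longrightarrow> \<iota> (E w) = mat_exp (D w)"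
    using E(3) unfolding eventually_nhds by blast
  have "((\<lambda>w. \<delta> (mat_exp (D w))) has_derivative (\<lambda>w. D' (id w))) (at 0)"
    by (rule has_derivative_transform_within_open[OF dE N(1,2)]) (simp add: N(3))
  then show thesis by (rule that)
qed

end

section \<open>First-order expansions at 0\<close>

text \<open>Values at \<open>t = 0\<close> are irrelevant, so that only eventual properties of curves are needed.\<close>

definition tangent :: "(real \<Rightarrow> 'a::real_normed_vector) \<Rightarrow> 'a \<Rightarrow> 'a \<Rightarrow> bool" where
  "tangent f a a' \<longleftrightarrow> ((\<lambda>t. (1 / t) *\<^sub>R (f t - a)) \<longlongrightarrow> a') (at 0)"

lemma tendsto_0_if_scaled:
  fixes f :: "real \<Rightarrow> 'a::real_normed_vector"
  assumes "((\<lambda>t. (1 / t ^ k) *\<^sub>R f t) \<longlongrightarrow> v) (at 0)" "0 < k"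
  shows "(f \<longlongrightarrow> 0) (at 0)"
proof -
  have "((\<lambda>t. t ^ k *\<^sub>R ((1 / t ^ k) *\<^sub>R f t)) \<longlongrightarrow> 0 ^ k *\<^sub>R v) (at 0)"
    by (intro tendsto_intros assms(1))
  then have "((\<lambda>t. t ^ k *\<^sub>R ((1 / t ^ k) *\<^sub>R f t)) \<longlongrightarrow> 0) (at 0)"
    using assms(2) by (simp add: zero_power)
  then show ?thesis
    by (rule Lim_transform_eventually) (auto simp: eventually_at intro!: exI[of _ 1])
qed

lemma tangent_tendsto: "tangent f a a' \<Longrightarrow> (f \<longlongrightarrow> a) (at 0)"
  unfolding tangent_def
  by (rule LIM_zero_cancel, rule tendsto_0_if_scaled[where k = 1]) simp_all

lemma tangent_cong:
  assumes "tangent f a a'" "\<forall>\<^sub>F t in at 0. f t = g t"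
  shows "tangent g a a'"
  using assms(1) unfolding tangent_def
  by (rule Lim_transform_eventually) (use assms(2) in \<open>auto elim: eventually_mono\<close>)

lemma tangent_const: "tangent (\<lambda>t. a) a 0"
  by (simp add: tangent_def)

lemma tangent_add:
  assumes "tangent f a a'" "tangent g b b'"
  shows "tangent (\<lambda>t. f t + g t) (a + b) (a' + b')"
  using tendsto_add[OF assms[unfolded tangent_def]]
  unfolding tangent_def by (simp add: algebra_simps)

lemma tangent_diff:
  assumes "tangent f a a'" "tangent g b b'"
  shows "tangent (\<lambda>t. f t - g t) (a - b) (a' - b')"
  using tendsto_diff[OF assms[unfolded tangent_def]]
  unfolding tangent_def by (simp add: algebra_simps)

lemma tangent_mult:
  fixes f g :: "real \<Rightarrow> real^'n^'n"
  assumes "tangent f a a'" "tangent g b b'"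
  shows "tangent (\<lambda>t. f t ** g t) (a ** b) (a' ** b + a ** b')"
proof -
  have "((\<lambda>t. ((1 / t) *\<^sub>R (f t - a)) ** g t + a ** ((1 / t) *\<^sub>R (g t - b))) \<longlongrightarrow> a' ** b + a ** b') (at 0)"
    by (rule tendsto_add[OF mm.tendsto[OF assms(1)[unfolded tangent_def] tangent_tendsto[OF assms(2)]]
          mm.tendsto[OF tendsto_const[of a] assms(2)[unfolded tangent_def]]])
  then show ?thesis
    unfolding tangent_def by (simp add: matrix_ring_simps algebra_simps)
qed

text \<open>Rests on \<open>x^-1 - a^-1 = - x^-1 (x - a) a^-1\<close>. Continuity of the inverse
  comes first; it needs a bound on \<open>x^-1\<close>, which the same identity gives once
  \<open>norm (x - a) * norm (a^-1) < 1 / 2\<close>.\<close>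

lemma tangent_matrix_inv:
  fixes f :: "real \<Rightarrow> real^'n^'n"
  assumes f: "tangent f a a'" and a: "invertible a" and inv: "\<forall>\<^sub>F t in at 0. invertible (f t)"
  shows "tangent (\<lambda>t. matrix_inv (f t)) (matrix_inv a) (- (matrix_inv a ** a' ** matrix_inv a))"
proof -
  let ?b = "matrix_inv a"
  have eq: "matrix_inv x - ?b = - (matrix_inv x ** (x - a) ** ?b)" if "invertible x" for x
  proof -
    have "matrix_inv x ** (x - a) ** ?b = (matrix_inv x ** x) ** ?b - matrix_inv x ** (a ** ?b)"
      by (simp add: matrix_ring_simps)
    then show ?thesis
      using matrix_inv_mult[OF that] matrix_inv_mult[OF a] by simp
  qed
  have fa: "(f \<longlongrightarrow> a) (at 0)" using f by (rule tangent_tendsto)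
  then have lim0: "((\<lambda>t. norm (f t - a) * norm ?b) \<longlongrightarrow> 0) (at 0)"
    by (intro tendsto_mult_left_zero tendsto_norm_zero LIM_zero)
  then have "\<forall>\<^sub>F t in at 0. norm (f t - a) * norm ?b < 1 / 2"
    by (rule order_tendstoD) simp
  with inv have bound: "\<forall>\<^sub>F t in at 0. norm (matrix_inv (f t) - ?b) \<le> 2 * norm ?b * (norm (f t - a) * norm ?b)"
  proof eventually_elim
    case (elim t)
    let ?X = "matrix_inv (f t)"
    have "norm (?X - ?b) = norm (?X ** (f t - a) ** ?b)"
      by (simp add: eq[OF elim(1)])
    also have "\<dots> \<le> norm ?X * (norm (f t - a) * norm ?b)"
      by (metis (no_types) matrix_mul_assoc mult_left_mono norm_ge_zero norm_matrix_mult_le order_trans)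
    finally have 1: "norm (?X - ?b) \<le> norm ?X * (norm (f t - a) * norm ?b)" .
    also have "\<dots> \<le> norm ?X * (1 / 2)"
      using elim(2) by (intro mult_left_mono) auto
    finally have "norm ?X \<le> 2 * norm ?b"
      using norm_triangle_sub[of ?X ?b] by linarith
    then show ?case
      using 1 by (meson mult_nonneg_nonneg mult_right_mono norm_ge_zero order_trans)
  qed
  have "((\<lambda>t. matrix_inv (f t) - ?b) \<longlongrightarrow> 0) (at 0)"
    by (rule Lim_null_comparison[OF bound]) (rule tendsto_mult_right_zero[OF lim0])
  then have "((\<lambda>t. matrix_inv (f t)) \<longlongrightarrow> ?b) (at 0)"
    by (rule LIM_zero_cancel)
  then have "((\<lambda>t. - (matrix_inv (f t) ** ((1 / t) *\<^sub>R (f t - a)) ** ?b)) \<longlongrightarrow> - (?b ** a' ** ?b)) (at 0)"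
    using f by (intro tendsto_minus mm.tendsto tendsto_const) (simp_all add: tangent_def)
  then show ?thesis
    unfolding tangent_def
  proof (rule Lim_transform_eventually)
    show "\<forall>\<^sub>F t in at 0. - (matrix_inv (f t) ** ((1 / t) *\<^sub>R (f t - a)) ** ?b) = (1 / t) *\<^sub>R (matrix_inv (f t) - ?b)"
      using inv by eventually_elim (simp add: eq mm.scaleR_left mm.scaleR_right)
  qed
qed

lemma tangent_if_has_vector_derivative:
  "(f has_vector_derivative f') (at 0) \<Longrightarrow> tangent f (f 0) f'"
  unfolding tangent_def by (rule has_vector_derivative_quotient_tendsto)

lemma invertible_one [simp]: "invertible (mat 1 :: real^'n^'n)"
  by (simp add: invertible_def)

text \<open>The curve minus the identity is \<open>(X Y - Y X) (Y X)^-1\<close>, and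
  \<open>X Y - Y X\<close> is also the commutator of \<open>X - 1\<close> and \<open>Y - 1\<close>,
  whose products have two factors of order \<open>t\<close>. First derivatives thus determine a
  limit of second order.\<close>

lemma tangent_group_commutator:
  fixes X Y :: "real \<Rightarrow> real^'n^'n"
  assumes X: "tangent X (mat 1) a" and Y: "tangent Y (mat 1) b"
    and inv: "\<forall>\<^sub>F t in at 0. invertible (Y t ** X t)"
  shows "((\<lambda>t. (1 / t\<^sup>2) *\<^sub>R (X t ** Y t ** matrix_inv (Y t ** X t) - mat 1)) \<longlongrightarrow> commutator a b) (at 0)"
proof -
  let ?I = "\<lambda>t. matrix_inv (Y t ** X t)"
  have "tangent (\<lambda>t. Y t ** X t) (mat 1) (b + a)"
    using tangent_mult[OF Y X] by simp
  from tangent_tendsto[OF tangent_matrix_inv[OF this invertible_one inv]]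
  have "(?I \<longlongrightarrow> mat 1) (at 0)" by simp
  then have "((\<lambda>t. (((1 / t) *\<^sub>R (X t - mat 1)) ** ((1 / t) *\<^sub>R (Y t - mat 1))
        - ((1 / t) *\<^sub>R (Y t - mat 1)) ** ((1 / t) *\<^sub>R (X t - mat 1))) ** ?I t)
      \<longlongrightarrow> (a ** b - b ** a) ** mat 1) (at 0)"
    using X Y by (intro mm.tendsto tendsto_diff) (simp_all add: tangent_def)
  then have "((\<lambda>t. (((1 / t) *\<^sub>R (X t - mat 1)) ** ((1 / t) *\<^sub>R (Y t - mat 1))
        - ((1 / t) *\<^sub>R (Y t - mat 1)) ** ((1 / t) *\<^sub>R (X t - mat 1))) ** ?I t)
      \<longlongrightarrow> commutator a b) (at 0)"
    by (simp add: commutator_def)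
  then show ?thesis
  proof (rule Lim_transform_eventually)
    show "\<forall>\<^sub>F t in at 0. (((1 / t) *\<^sub>R (X t - mat 1)) ** ((1 / t) *\<^sub>R (Y t - mat 1))
        - ((1 / t) *\<^sub>R (Y t - mat 1)) ** ((1 / t) *\<^sub>R (X t - mat 1))) ** ?I t
        = (1 / t\<^sup>2) *\<^sub>R (X t ** Y t ** ?I t - mat 1)"
      using inv
    proof eventually_elim
      case (elim t)
      have "((1 / t) *\<^sub>R (X t - mat 1)) ** ((1 / t) *\<^sub>R (Y t - mat 1))
          - ((1 / t) *\<^sub>R (Y t - mat 1)) ** ((1 / t) *\<^sub>R (X t - mat 1))
          = (1 / t\<^sup>2) *\<^sub>R (X t ** Y t - Y t ** X t)"
        by (simp add: matrix_ring_simps scaleR_diff_right power2_eq_square)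
      then show ?case
        using matrix_inv_mult(1)[OF elim] by (simp add: mm.scaleR_left mm.diff_left)
    qed
  qed
qed

section \<open>Logarithms of curves in the group\<close>

lemma eventually_scaleR_if_nhds_0:
  fixes F :: "'k::euclidean_space \<Rightarrow> bool"
  assumes "\<forall>\<^sub>F w in nhds 0. F w"
  shows "\<forall>\<^sub>F t in at (0::real). F (t *\<^sub>R w)"
proof -
  have "((\<lambda>t. t *\<^sub>R w) \<longlongrightarrow> 0 *\<^sub>R w) (at 0)"
    by (intro tendsto_intros)
  then have "filterlim (\<lambda>t. t *\<^sub>R w) (nhds 0) (at 0)" by simp
  with assms show ?thesis by (rule eventually_compose_filterlim)
qed

text \<open>Both coordinate curves are eventually in the ball of radius \<open>1/4\<close> on which
  the exponential is injective, so they agree near \<open>0\<close>. This justifies the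
  \<open>THE\<close> in \<open>loop_bracket\<close> and \<open>loop_associator\<close>.\<close>

lemma has_coord_limit_unique:
  assumes "has_coord_limit \<mm> k g v" "has_coord_limit \<mm> k g v'"
  shows "v = v'"
proof -
  have ev: "\<forall>\<^sub>F t in at 0. norm (snd (c t)) \<le> 1 / 4" if "(c \<longlongrightarrow> 0) (at 0)" for c :: "real \<Rightarrow> (real^'n) \<times> (real^'n^'n)"
  proof -
    have "\<forall>\<^sub>F t in at 0. norm (snd (c t)) < 1 / 4"
      using tendsto_norm[OF tendsto_snd[OF that]] by (rule order_tendstoD) simp
    then show ?thesis by (rule eventually_mono) simp
  qed
  obtain c where c: "\<forall>\<^sub>F t in at 0. snd (c t) \<in> \<mm> \<and> g t = (fst (c t), mat_exp (snd (c t)))"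
    "(c \<longlongrightarrow> 0) (at 0)" "((\<lambda>t. (1 / t ^ k) *\<^sub>R c t) \<longlongrightarrow> v) (at 0)"
    using assms(1) unfolding has_coord_limit_def by blast
  obtain c' where c': "\<forall>\<^sub>F t in at 0. snd (c' t) \<in> \<mm> \<and> g t = (fst (c' t), mat_exp (snd (c' t)))"
    "(c' \<longlongrightarrow> 0) (at 0)" "((\<lambda>t. (1 / t ^ k) *\<^sub>R c' t) \<longlongrightarrow> v') (at 0)"
    using assms(2) unfolding has_coord_limit_def by blast
  have "\<forall>\<^sub>F t in at 0. (1 / t ^ k) *\<^sub>R c t = (1 / t ^ k) *\<^sub>R c' t"
    using c(1) c'(1) ev[OF c(2)] ev[OF c'(2)]
  proof eventually_elim
    case (elim t)
    then have "norm (snd (c t) - snd (c' t)) \<le> 0"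
      using mat_exp_lower_lipschitz[of "snd (c t)" "snd (c' t)"] by simp
    with elim have "c t = c' t" by (simp add: prod_eq_iff)
    then show ?case by simp
  qed
  then have "((\<lambda>t. (1 / t ^ k) *\<^sub>R c' t) \<longlongrightarrow> v) (at 0)"
    by (rule Lim_transform_eventually[OF c(3)])
  with c'(3) show ?thesis using tendsto_unique trivial_limit_at by blast
qed

section \<open>Curves tending to the identity in the manifold topology\<close>

context lie_chart
begin

lemma eventually_exp_in:
  assumes "openin T W" "mat 1 \<in> W"
  shows "\<forall>\<^sub>F w in nhds 0. mat_exp (D w) \<in> W"
proof (rule exp_chart)
  assume "\<And>W. openin T W \<Longrightarrow> mat 1 \<in> W \<Longrightarrow> \<forall>\<^sub>F w in nhds 0. mat_exp (D w) \<in> W"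
  with assms show ?thesis by blast
qed

lemma exp_covers_nhd:
  assumes "0 < e"
  shows "\<exists>W. openin T W \<and> mat 1 \<in> W \<and> W \<subseteq> (\<lambda>w. mat_exp (D w)) ` ball 0 e"
proof (rule exp_chart)
  assume "\<And>e. 0 < e \<Longrightarrow> \<exists>W. openin T W \<and> mat 1 \<in> W \<and> W \<subseteq> (\<lambda>w. mat_exp (D w)) ` ball 0 e"
  with assms show ?thesis by blast
qed

text \<open>Convergence to the identity in \<open>T\<close>. Convergence as matrices could be
  weaker, and \<open>exp_covers_nhd\<close> yields logarithms only for elements of a neighbourhood
  in \<open>T\<close>.\<close>

definition near_one where
  "near_one g \<longleftrightarrow> (\<forall>W. openin T W \<longrightarrow> mat 1 \<in> W \<longrightarrow> (\<forall>\<^sub>F t in at (0::real). g t \<in> W))"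

lemma near_one_in: "near_one g \<Longrightarrow> \<forall>\<^sub>F t in at 0. g t \<in> \<Gamma>"
  using one_in unfolding near_one_def topspace_T[symmetric] by blast

lemma near_one_exp: "near_one (\<lambda>t. mat_exp (t *\<^sub>R D w))"
  unfolding near_one_def
proof (intro allI impI)
  fix W assume "openin T W" "mat 1 \<in> W"
  then have "\<forall>\<^sub>F w in nhds 0. mat_exp (D w) \<in> W"
    by (rule eventually_exp_in)
  from eventually_scaleR_if_nhds_0[OF this, of w]
  show "\<forall>\<^sub>F t in at 0. mat_exp (t *\<^sub>R D w) \<in> W"
    by (simp add: linear_simps[OF bounded_linear_D])
qed

lemma near_one_mult:
  assumes "near_one f" "near_one g"
  shows "near_one (\<lambda>t. f t ** g t)"
  unfolding near_one_def
proof (intro allI impI)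
  fix W assume "openin T W" "mat 1 \<in> W"
  then obtain W' where W': "openin T W'" "mat 1 \<in> W'" "\<And>M N. M \<in> W' \<Longrightarrow> N \<in> W' \<Longrightarrow> M ** N \<in> W"
    using mult_nhd by blast
  then have "\<forall>\<^sub>F t in at 0. f t \<in> W'" "\<forall>\<^sub>F t in at 0. g t \<in> W'"
    using assms by (auto simp: near_one_def)
  then show "\<forall>\<^sub>F t in at 0. f t ** g t \<in> W"
    by eventually_elim (rule W'(3))
qed

lemma near_one_inv:
  assumes "near_one f"
  shows "near_one (\<lambda>t. matrix_inv (f t))"
  unfolding near_one_def
proof (intro allI impI)
  fix W assume "openin T W" "mat 1 \<in> W"
  then obtain W' where W': "openin T W'" "mat 1 \<in> W'" "\<And>M. M \<in> W' \<Longrightarrow> matrix_inv M \<in> W"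
    using inv_nhd by blast
  then have "\<forall>\<^sub>F t in at 0. f t \<in> W'"
    using assms by (auto simp: near_one_def)
  then show "\<forall>\<^sub>F t in at 0. matrix_inv (f t) \<in> W"
    by eventually_elim (rule W'(3))
qed

text \<open>Logarithms exist because the curve enters a neighbourhood covered by the exponential.
  They differ from \<open>g t - mat 1\<close> by at most a constant times
  \<open>norm (D (w t)) * norm (g t - mat 1)\<close>, so division by \<open>t ^ k\<close> leads to
  the same limit.\<close>

lemma near_one_log:
  assumes g: "near_one g" and lim: "((\<lambda>t. (1 / t ^ k) *\<^sub>R (g t - mat 1)) \<longlongrightarrow> v) (at 0)" and "0 < k"
  obtains w where "\<forall>\<^sub>F t in at 0. g t = mat_exp (D (w t))"
    "((\<lambda>t. D (w t)) \<longlongrightarrow> 0) (at 0)" "((\<lambda>t. (1 / t ^ k) *\<^sub>R D (w t)) \<longlongrightarrow> v) (at 0)"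
proof -
  have g1: "((\<lambda>t. g t - mat 1) \<longlongrightarrow> 0) (at 0)"
    using lim \<open>0 < k\<close> by (rule tendsto_0_if_scaled)
  obtain L where L: "L > 0" "\<And>v. norm (D v) \<le> norm v * L"
    using bounded_linear.pos_bounded[OF bounded_linear_D] by blast
  \<comment> \<open>On this radius \<open>norm (D w) \<le> 1 / 4\<close>, where
    \<open>mat_exp_lower_lipschitz\<close> applies.\<close>
  have "0 < 1 / (4 * L)" using L by simp
  then obtain W where W: "openin T W" "mat 1 \<in> W" "W \<subseteq> (\<lambda>w. mat_exp (D w)) ` ball 0 (1 / (4 * L))"
    using exp_covers_nhd by blast
  have "\<exists>w. norm (D w) \<le> 1 / 4 \<and> M = mat_exp (D w)" if "M \<in> W" for M
  proof -
    from that W(3) obtain w where w: "norm w < 1 / (4 * L)" "M = mat_exp (D w)" by auto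
    then have "norm (D w) \<le> 1 / 4"
      using L(2)[of w] L(1) by (simp add: field_simps)
    then show ?thesis using w by blast
  qed
  then obtain lg where lg: "\<And>M. M \<in> W \<Longrightarrow> norm (D (lg M)) \<le> 1 / 4 \<and> M = mat_exp (D (lg M))"
    by metis
  define c where "c t = D (lg (g t))" for t
  have evW: "\<forall>\<^sub>F t in at 0. g t \<in> W" using g W by (auto simp: near_one_def)
  then have ev: "\<forall>\<^sub>F t in at 0. g t = mat_exp (c t) \<and> norm (c t) \<le> 2 * norm (g t - mat 1) \<and> norm (c t) \<le> 1"
  proof eventually_elim
    case (elim t)
    have "norm (c t) \<le> 1 / 4" "g t = mat_exp (c t)"
      using lg[OF elim] by (simp_all add: c_def)
    then show ?case
      using mat_exp_lower_lipschitz[of "c t" 0] by simp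
  qed
  have c0: "(c \<longlongrightarrow> 0) (at 0)"
    by (rule Lim_null_comparison[OF _ tendsto_mult_right_zero[OF tendsto_norm_zero[OF g1]], of _ 2])
      (use ev in \<open>auto elim: eventually_mono\<close>)
  have "((\<lambda>t. (1 / t ^ k) *\<^sub>R c t - (1 / t ^ k) *\<^sub>R (g t - mat 1)) \<longlongrightarrow> 0) (at 0)"
  proof (rule Lim_null_comparison)
    have "((\<lambda>t. 2 * norm (c t) * (2 * norm ((1 / t ^ k) *\<^sub>R (g t - mat 1)))) \<longlongrightarrow> 2 * norm (0 :: real^'n^'n) * (2 * norm v)) (at 0)"
      by (intro tendsto_intros c0 lim)
    then show "((\<lambda>t. 2 * norm (c t) * (2 * norm ((1 / t ^ k) *\<^sub>R (g t - mat 1)))) \<longlongrightarrow> 0) (at 0)"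
      by simp
    show "\<forall>\<^sub>F t in at 0. norm ((1 / t ^ k) *\<^sub>R c t - (1 / t ^ k) *\<^sub>R (g t - mat 1))
        \<le> 2 * norm (c t) * (2 * norm ((1 / t ^ k) *\<^sub>R (g t - mat 1)))"
      using ev
    proof eventually_elim
      case (elim t)
      have "norm (c t - (g t - mat 1)) \<le> 2 * norm (c t) * norm (c t)"
        using norm_mat_exp_diff_linear_le_small[of "c t" "norm (c t)" 0] elim
        by (simp add: norm_minus_commute)
      also have "\<dots> \<le> 2 * norm (c t) * (2 * norm (g t - mat 1))"
        using elim by (intro mult_left_mono) auto
      finally have "\<bar>1 / t ^ k\<bar> * norm (c t - (g t - mat 1)) \<le> \<bar>1 / t ^ k\<bar> * (2 * norm (c t) * (2 * norm (g t - mat 1)))"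
        by (rule mult_left_mono) simp
      then show ?case
        unfolding scaleR_diff_right[symmetric] norm_scaleR by (simp only: mult_ac)
    qed
  qed
  then have "((\<lambda>t. (1 / t ^ k) *\<^sub>R c t) \<longlongrightarrow> v) (at 0)"
    by (rule Lim_transform[OF lim])
  moreover have "\<forall>\<^sub>F t in at 0. g t = mat_exp (D (lg (g t)))"
    using ev unfolding c_def by (rule eventually_mono) simp
  ultimately show thesis
    using that[of "\<lambda>t. lg (g t)"] c0 unfolding c_def by blast
qed

lemma D_lower: obtains b where "b > 0" "\<And>w. b * norm w \<le> norm (D w)"
  using linear_inj_bounded_below_pos[OF bounded_linear.linear[OF bounded_linear_D] inj_D] by blast

lemma D_tendsto_cancel:
  assumes "((\<lambda>t. D (w t)) \<longlongrightarrow> D v) F"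
  shows "(w \<longlongrightarrow> v) F"
proof -
  obtain b where b: "b > 0" "\<And>w. b * norm w \<le> norm (D w)" using D_lower by blast
  have "((\<lambda>t. w t - v) \<longlongrightarrow> 0) F"
  proof (rule Lim_null_comparison)
    show "\<forall>\<^sub>F t in F. norm (w t - v) \<le> (1 / b) * norm (D (w t) - D v)"
      using b(2)[of "w _ - v"] b(1)
      by (intro always_eventually allI) (simp add: linear_simps[OF bounded_linear_D] field_simps)
    show "((\<lambda>t. (1 / b) * norm (D (w t) - D v)) \<longlongrightarrow> 0) F"
      by (rule tendsto_mult_right_zero[OF tendsto_norm_zero[OF LIM_zero[OF assms]]])
  qed
  then show ?thesis by (rule LIM_zero_cancel)
qed

text \<open>The commutator of two elements of \<open>range D\<close> is a limit of scaled
  logarithms, which lie in the closed subspace \<open>range D\<close>. This is how the Lie algebra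
  is seen to be closed under commutators.\<close>

lemma commutator_curve_log:
  fixes w1 w2
  defines "C \<equiv> \<lambda>t. mat_exp (t *\<^sub>R D w1) ** mat_exp (t *\<^sub>R D w2) ** matrix_inv (mat_exp (t *\<^sub>R D w2) ** mat_exp (t *\<^sub>R D w1))"
  obtains w w0 where "\<forall>\<^sub>F t in at 0. C t = mat_exp (D (w t))" "D w0 = commutator (D w1) (D w2)"
    "(w \<longlongrightarrow> 0) (at 0)" "((\<lambda>t. (1 / t ^ 2) *\<^sub>R w t) \<longlongrightarrow> w0) (at 0)"
proof -
  have tan: "tangent (\<lambda>t. mat_exp (t *\<^sub>R X)) (mat 1) X" for X :: "real^'n^'n"
    using tangent_if_has_vector_derivative[OF mat_exp_has_vector_derivative[of X 0]] by simp
  have n: "near_one C" unfolding C_def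
    by (intro near_one_mult near_one_inv near_one_exp)
  have "\<forall>\<^sub>F t in at 0. invertible (mat_exp (t *\<^sub>R D w2) ** mat_exp (t *\<^sub>R D w1))"
    using near_one_in[OF near_one_mult[OF near_one_exp near_one_exp]]
    by (rule eventually_mono) (rule invertible_\<Gamma>)
  from tangent_group_commutator[OF tan tan this]
  have "((\<lambda>t. (1 / t ^ 2) *\<^sub>R (C t - mat 1)) \<longlongrightarrow> commutator (D w1) (D w2)) (at 0)"
    unfolding C_def .
  from near_one_log[OF n this] obtain w where w: "\<forall>\<^sub>F t in at 0. C t = mat_exp (D (w t))"
    "((\<lambda>t. D (w t)) \<longlongrightarrow> 0) (at 0)" "((\<lambda>t. (1 / t ^ 2) *\<^sub>R D (w t)) \<longlongrightarrow> commutator (D w1) (D w2)) (at 0)"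
    by auto
  have D: "(1 / t ^ 2) *\<^sub>R D (w t) = D ((1 / t ^ 2) *\<^sub>R w t)" for t
    by (simp add: linear_simps[OF bounded_linear_D])
  have "closed (range D)"
    using bounded_linear.linear[OF bounded_linear_D] by (intro closed_subspace linear_subspace_image subspace_UNIV)
  then have "commutator (D w1) (D w2) \<in> range D"
    by (rule Lim_in_closed_set[OF _ _ _ w(3)[unfolded D]]) auto
  then obtain w0 where w0: "D w0 = commutator (D w1) (D w2)" by (metis imageE)
  have "(w \<longlongrightarrow> 0) (at 0)"
    using w(2) by (intro D_tendsto_cancel) (simp add: linear_simps[OF bounded_linear_D])
  moreover have "((\<lambda>t. (1 / t ^ 2) *\<^sub>R w t) \<longlongrightarrow> w0) (at 0)"
    using w(3) unfolding D w0[symmetric] by (rule D_tendsto_cancel)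
  ultimately show thesis using that w(1) w0 by blast
qed

end

lemma bounded_linear_matrix_vector_left: "bounded_linear (\<lambda>X :: real^'n^'n. X *v x)"
  unfolding linear_conv_bounded_linear[symmetric]
  by (rule linearI) (simp_all add: matrix_vector_mult_add_rdistrib scaleR_matrix_vector_assoc)

section \<open>The Akivis operations\<close>

context xi_loop
begin

section \<open>The differential of the endomorphism and its compatibility with commutators\<close>

definition "D' = frechet_derivative (\<lambda>w. \<delta> (mat_exp (D w))) (at 0)"

lemma has_derivative_D': "((\<lambda>w. \<delta> (mat_exp (D w))) has_derivative D') (at 0)"
  by (rule \<delta>_exp_has_derivative) (metis D'_def frechet_derivative_at)

lemma bounded_linear_D': "bounded_linear D'"
  using has_derivative_D' by (rule has_derivative_bounded_linear)

lemma D_0: "D 0 = 0"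
  by (simp add: linear_simps[OF bounded_linear_D])

text \<open>The velocities of \<open>M\<close> and of its image under \<open>\<delta>\<close> are
  recorded together. On exponential curves they are \<open>D w\<close> and \<open>D' w\<close>, and
  the homomorphism property carries them through products and inverses, so \<open>\<delta>\<close>
  is differentiated only along exponentials.\<close>

definition curve where
  "curve M a a' \<longleftrightarrow> near_one M \<and> tangent M (mat 1) a \<and> tangent (\<lambda>t. \<delta> (M t)) (mat 1) a'"

lemma curve_in: "curve M a a' \<Longrightarrow> \<forall>\<^sub>F t in at 0. M t \<in> \<Gamma>"
  by (simp add: curve_def near_one_in)

lemma curve_exp: "curve (\<lambda>t. mat_exp (t *\<^sub>R D w)) (D w) (D' w)"
proof -
  have "((\<lambda>t. t *\<^sub>R w) has_derivative (\<lambda>t. t *\<^sub>R w)) (at 0)"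
    by (auto intro!: derivative_eq_intros)
  then have "((\<lambda>t. \<delta> (mat_exp (D (t *\<^sub>R w)))) has_derivative (\<lambda>t. D' (t *\<^sub>R w))) (at 0)"
    by (rule has_derivative_compose) (simp add: has_derivative_D')
  then have "((\<lambda>t. \<delta> (mat_exp (t *\<^sub>R D w))) has_vector_derivative D' w) (at 0)"
    by (simp add: has_vector_derivative_def linear_simps[OF bounded_linear_D] linear_simps[OF bounded_linear_D'])
  from tangent_if_has_vector_derivative[OF this]
    tangent_if_has_vector_derivative[OF mat_exp_has_vector_derivative[of "D w" 0]]
  show ?thesis
    by (simp add: curve_def near_one_exp \<delta>_one)
qed

lemma curve_mult:
  assumes "curve M a a'" "curve N b b'"
  shows "curve (\<lambda>t. M t ** N t) (a + b) (a' + b')"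
proof -
  have "tangent (\<lambda>t. \<delta> (M t) ** \<delta> (N t)) (mat 1) (a' + b')"
    using tangent_mult[of "\<lambda>t. \<delta> (M t)" "mat 1" a' "\<lambda>t. \<delta> (N t)" "mat 1" b'] assms by (simp add: curve_def)
  moreover have "\<forall>\<^sub>F t in at 0. \<delta> (M t) ** \<delta> (N t) = \<delta> (M t ** N t)"
    using curve_in[OF assms(1)] curve_in[OF assms(2)] by eventually_elim (simp add: \<delta>_mult)
  ultimately have "tangent (\<lambda>t. \<delta> (M t ** N t)) (mat 1) (a' + b')"
    by (rule tangent_cong)
  then show ?thesis
    using tangent_mult[of M "mat 1" a N "mat 1" b] near_one_mult assms by (simp add: curve_def)
qed

lemma curve_inv:
  assumes "curve M a a'"
  shows "curve (\<lambda>t. matrix_inv (M t)) (- a) (- a')"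
proof -
  have inv: "\<forall>\<^sub>F t in at 0. invertible (M t)" "\<forall>\<^sub>F t in at 0. invertible (\<delta> (M t))"
    using curve_in[OF assms] by (auto elim!: eventually_mono intro: invertible_\<Gamma> \<delta>_in)
  have "tangent (\<lambda>t. matrix_inv (\<delta> (M t))) (mat 1) (- a')"
    using tangent_matrix_inv[OF _ _ inv(2), of "mat 1" a'] assms by (simp add: curve_def)
  moreover have "\<forall>\<^sub>F t in at 0. matrix_inv (\<delta> (M t)) = \<delta> (matrix_inv (M t))"
    using curve_in[OF assms] by eventually_elim (rule matrix_inv_eqI[OF \<delta>_inv])
  ultimately have "tangent (\<lambda>t. \<delta> (matrix_inv (M t))) (mat 1) (- a')"
    by (rule tangent_cong)
  then show ?thesis
    using tangent_matrix_inv[OF _ _ inv(1), of "mat 1" a] near_one_inv assms by (simp add: curve_def)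
qed

text \<open>The image under \<open>\<delta>\<close> of the group commutator of two exponential
  curves is expanded to order \<open>t^2\<close> in two ways: as the group commutator of the images,
  and through its logarithm \<open>c t\<close> and the derivative \<open>D'\<close>. Since
  \<open>c t\<close> is itself of order \<open>t^2\<close>, first-order differentiability at
  \<open>0\<close> suffices.\<close>

lemma D'_commutator:
  assumes "D w = commutator (D w1) (D w2)"
  shows "D' w = commutator (D' w1) (D' w2)"
proof -
  let ?X = "\<lambda>t. mat_exp (t *\<^sub>R D w1)" and ?Y = "\<lambda>t. mat_exp (t *\<^sub>R D w2)"
  let ?C = "\<lambda>t. ?X t ** ?Y t ** matrix_inv (?Y t ** ?X t)"
  obtain c w0 where c: "\<forall>\<^sub>F t in at 0. ?C t = mat_exp (D (c t))" "D w0 = commutator (D w1) (D w2)"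
    "(c \<longlongrightarrow> 0) (at 0)" "((\<lambda>t. (1 / t ^ 2) *\<^sub>R c t) \<longlongrightarrow> w0) (at 0)"
    by (rule commutator_curve_log)
  have "w0 = w" using c(2) assms inj_D by (metis injD)
  have evX: "\<forall>\<^sub>F t in at 0. ?X t \<in> \<Gamma>" and evY: "\<forall>\<^sub>F t in at 0. ?Y t \<in> \<Gamma>"
    using curve_in[OF curve_exp] by auto
  have inv: "\<forall>\<^sub>F t in at 0. invertible (\<delta> (?Y t) ** \<delta> (?X t))"
    using evX evY by eventually_elim (intro invertible_\<Gamma> mult_in \<delta>_in)
  have "((\<lambda>t. (1 / t\<^sup>2) *\<^sub>R (\<delta> (?X t) ** \<delta> (?Y t) ** matrix_inv (\<delta> (?Y t) ** \<delta> (?X t)) - mat 1))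
      \<longlongrightarrow> commutator (D' w1) (D' w2)) (at 0)"
    using curve_exp[of w1] curve_exp[of w2] by (intro tangent_group_commutator inv) (simp_all add: curve_def)
  then have lim: "((\<lambda>t. (1 / t\<^sup>2) *\<^sub>R (\<delta> (mat_exp (D (c t))) - mat 1)) \<longlongrightarrow> commutator (D' w1) (D' w2)) (at 0)"
  proof (rule Lim_transform_eventually)
    show "\<forall>\<^sub>F t in at 0. (1 / t\<^sup>2) *\<^sub>R (\<delta> (?X t) ** \<delta> (?Y t) ** matrix_inv (\<delta> (?Y t) ** \<delta> (?X t)) - mat 1)
        = (1 / t\<^sup>2) *\<^sub>R (\<delta> (mat_exp (D (c t))) - mat 1)"
      using evX evY c(1)
    proof eventually_elim
      case (elim t)
      have "\<delta> (?C t) = \<delta> (?X t) ** \<delta> (?Y t) ** matrix_inv (\<delta> (?Y t) ** \<delta> (?X t))"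
        using elim(1,2) by (simp add: \<delta>_mult mult_in inv_in flip: matrix_inv_eqI[OF \<delta>_inv])
      then show ?case using elim(3) by simp
    qed
  qed
  obtain e where e: "\<And>h. \<delta> (mat_exp (D h)) = mat 1 + D' h + e h" "((\<lambda>h. norm (e h) / norm h) \<longlongrightarrow> 0) (at 0)"
    using has_derivative_D' unfolding has_derivative_iff_Ex by (auto simp: D_0 \<delta>_one)
  have e0: "e 0 = 0" using e(1)[of 0] by (simp add: D_0 \<delta>_one linear_simps[OF bounded_linear_D'])
  \<comment> \<open>\<open>c t\<close> may vanish, so the limit is taken over full neighbourhoods of
    \<open>0\<close>. Division by zero gives \<open>0\<close>, which makes the value at
    \<open>0\<close> fit.\<close>
  have "((\<lambda>h. norm (e h) / norm h) \<longlongrightarrow> norm (e 0) / norm (0 :: 'k)) (nhds 0)"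
    using e(2) by (subst tendsto_at_iff_tendsto_nhds[symmetric]) simp
  then have "((\<lambda>t. norm (e (c t)) / norm (c t)) \<longlongrightarrow> norm (e 0) / norm (0 :: 'k)) (at 0)"
    by (rule filterlim_compose) (rule c(3))
  then have "((\<lambda>t. norm (e (c t)) / norm (c t) * norm ((1 / t ^ 2) *\<^sub>R c t)) \<longlongrightarrow> 0 * norm w0) (at 0)"
    by (intro tendsto_mult tendsto_norm c(4)) simp
  then have "((\<lambda>t. (1 / t\<^sup>2) *\<^sub>R e (c t)) \<longlongrightarrow> 0) (at 0)"
    by (intro Lim_null_comparison[of "\<lambda>t. (1 / t\<^sup>2) *\<^sub>R e (c t)" "\<lambda>t. norm (e (c t)) / norm (c t) * norm ((1 / t ^ 2) *\<^sub>R c t)"])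
      (auto simp: e0)
  from tendsto_add[OF bounded_linear.tendsto[OF bounded_linear_D' c(4)] this]
  have "((\<lambda>t. (1 / t\<^sup>2) *\<^sub>R (\<delta> (mat_exp (D (c t))) - mat 1)) \<longlongrightarrow> D' w0) (at 0)"
    by (simp add: e(1) linear_simps[OF bounded_linear_D'] scaleR_add_right)
  with lim show ?thesis
    using tendsto_unique trivial_limit_at unfolding \<open>w0 = w\<close> by blast
qed

section \<open>First-order expansion of the loop multiplication\<close>

definition "R = matrix_inv (B - A)"

lemma R_mult: "R ** (B - A) = mat 1" "(B - A) ** R = mat 1"
  using matrix_inv_mult[OF invertible_P[OF one_in]] by (simp_all add: R_def P_one)

lemma tangent_inv_P:
  assumes "curve M a a'"
  shows "tangent (\<lambda>t. matrix_inv (P (M t))) R (- (R ** (A ** a - a' ** A) ** R))"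
proof -
  have "\<forall>\<^sub>F t in at 0. invertible (M t)"
    using curve_in[OF assms] by (rule eventually_mono) (rule invertible_\<Gamma>)
  then have "tangent (\<lambda>t. matrix_inv (M t)) (mat 1) (- a)"
    using tangent_matrix_inv[of M "mat 1" a] assms by (simp add: curve_def)
  moreover have "tangent (\<lambda>t. \<delta> (M t)) (mat 1) a'" using assms by (simp add: curve_def)
  ultimately have "tangent (\<lambda>t. P (M t)) (B - A) (A ** a - a' ** A)"
    using tangent_diff[OF tangent_const[of B] tangent_mult[OF tangent_mult[OF _ tangent_const[of A]]],
        of "\<lambda>t. \<delta> (M t)" "mat 1" a' "\<lambda>t. matrix_inv (M t)" "mat 1" "- a"]
    by (simp add: P_def matrix_ring_simps)
  moreover have "\<forall>\<^sub>F t in at 0. invertible (P (M t))"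
    using curve_in[OF assms] by (rule eventually_mono) (rule invertible_P)
  ultimately show ?thesis
    unfolding R_def using invertible_P[OF one_in] by (intro tangent_matrix_inv) (simp_all add: P_one)
qed

text \<open>\<open>P (M ** N) ** M\<close> and \<open>\<delta> M ** P N\<close> agree in the terms
  that involve \<open>A\<close>. Their difference is the defect
  \<open>\<delta> M ** B - B ** M\<close>, which vanishes at \<open>M = mat 1\<close>.\<close>

lemma Q_eq:
  assumes "M \<in> \<Gamma>" "N \<in> \<Gamma>"
  shows "Q M N = M + matrix_inv (P (M ** N)) ** (\<delta> M ** B - B ** M)"
proof -
  have MN: "matrix_inv (M ** N) = matrix_inv N ** matrix_inv M"
  proof (rule matrix_inv_eqI)
    have "M ** N ** (matrix_inv N ** matrix_inv M) = M ** (N ** matrix_inv N) ** matrix_inv M"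
      by (simp add: matrix_mul_assoc)
    then show "M ** N ** (matrix_inv N ** matrix_inv M) = mat 1"
      using matrix_inv_mult(1)[OF invertible_\<Gamma>] assms by simp
  qed
  have "P (M ** N) ** M = B ** M - \<delta> M ** (\<delta> N ** A ** matrix_inv N) ** (matrix_inv M ** M)"
    using assms by (simp add: P_def \<delta>_mult MN matrix_ring_simps)
  then have eq: "\<delta> M ** P N = P (M ** N) ** M + (\<delta> M ** B - B ** M)"
    using matrix_inv_mult(2)[OF invertible_\<Gamma>[OF assms(1)]] by (simp add: P_def matrix_ring_simps)
  have "Q M N = matrix_inv (P (M ** N)) ** (\<delta> M ** P N)"
    by (simp add: Q_def matrix_mul_assoc)
  also have "\<dots> = (matrix_inv (P (M ** N)) ** P (M ** N)) ** M + matrix_inv (P (M ** N)) ** (\<delta> M ** B - B ** M)"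
    unfolding eq by (simp add: mm.add_right matrix_mul_assoc)
  finally show ?thesis
    using matrix_inv_mult(2)[OF invertible_P[OF mult_in[OF assms]]] by simp
qed

lemma Q_one: "N \<in> \<Gamma> \<Longrightarrow> Q (mat 1) N = mat 1"
  using Q_eq[OF one_in] by (simp add: \<delta>_one)

text \<open>The inner factor \<open>P (N ** S)\<close> cancels against its inverse. In the
  associator this makes the two contributions of the third vector cancel.\<close>

lemma Q_cocycle:
  assumes "M \<in> \<Gamma>" "N \<in> \<Gamma>" "S \<in> \<Gamma>"
  shows "Q M (N ** S) ** Q N S = Q (M ** N) S"
proof -
  have "Q M (N ** S) ** Q N S
      = matrix_inv (P (M ** (N ** S))) ** \<delta> M ** (P (N ** S) ** matrix_inv (P (N ** S))) ** \<delta> N ** P S"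
    by (simp add: Q_def matrix_mul_assoc)
  then show ?thesis
    using assms matrix_inv_mult(1)[OF invertible_P[OF mult_in]]
    by (simp add: Q_def \<delta>_mult matrix_mul_assoc)
qed

lemma tangent_\<delta>_defect:
  assumes "curve M a a'"
  shows "tangent (\<lambda>t. \<delta> (M t) ** B - B ** M t) 0 (a' ** B - B ** a)"
  using assms tangent_diff[OF tangent_mult[OF _ tangent_const[of B]] tangent_mult[OF tangent_const[of B]],
      of "\<lambda>t. \<delta> (M t)" "mat 1" a' M "mat 1" a]
  by (simp add: curve_def)

text \<open>In the product rule the derivative of the inverse of \<open>P\<close> is multiplied by
  the value of the defect at the identity, which is \<open>0\<close>; hence the velocity of
  \<open>N\<close> does not enter.\<close>

lemma tangent_Q:
  assumes M: "curve M a a'" and N: "curve N b b'"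
  shows "tangent (\<lambda>t. Q (M t) (N t)) (mat 1) (a + R ** (a' ** B - B ** a))"
proof -
  have "tangent (\<lambda>t. M t + matrix_inv (P (M t ** N t)) ** (\<delta> (M t) ** B - B ** M t)) (mat 1) (a + R ** (a' ** B - B ** a))"
    using tangent_add[OF _ tangent_mult[OF tangent_inv_P[OF curve_mult[OF M N]] tangent_\<delta>_defect[OF M]], of M "mat 1" a] M
    by (simp add: curve_def)
  moreover have "\<forall>\<^sub>F t in at 0. M t + matrix_inv (P (M t ** N t)) ** (\<delta> (M t) ** B - B ** M t) = Q (M t) (N t)"
    using curve_in[OF M] curve_in[OF N] by eventually_elim (simp add: Q_eq)
  ultimately show ?thesis by (rule tangent_cong)
qed

section \<open>Right division and the limits of the two curves\<close>

lemma right_div_eq: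
  assumes "M \<in> \<Gamma>" "N \<in> \<Gamma>"
  shows "right_div (UNIV \<times> \<Gamma>) (xi_mult A B \<delta>) (u, M) (v, N)
    = (u - Q (M ** matrix_inv N) N *v v, M ** matrix_inv N)"
  unfolding right_div_def
proof (rule the_equality)
  have N: "M ** matrix_inv N ** N = M"
    using matrix_inv_mult(2)[OF invertible_\<Gamma>[OF assms(2)]] by (simp flip: matrix_mul_assoc)
  show "(u - Q (M ** matrix_inv N) N *v v, M ** matrix_inv N) \<in> UNIV \<times> \<Gamma> \<and>
      xi_mult A B \<delta> (u - Q (M ** matrix_inv N) N *v v, M ** matrix_inv N) (v, N) = (u, M)"
    using assms N by (simp add: xi_mult_eq mult_in inv_in)
  fix x assume x: "x \<in> UNIV \<times> \<Gamma> \<and> xi_mult A B \<delta> x (v, N) = (u, M)"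
  obtain x1 X where [simp]: "x = (x1, X)" by (cases x)
  from x have "x1 + Q X N *v v = u" "X ** N = M" by (simp_all add: xi_mult_eq)
  moreover from this have "X = M ** matrix_inv N"
    using matrix_inv_mult(1)[OF invertible_\<Gamma>[OF assms(2)]] by (metis matrix_mul_assoc matrix_mul_rid)
  ultimately show "x = (u - Q (M ** matrix_inv N) N *v v, M ** matrix_inv N)" by auto
qed

lemma exp_curve_eq: "exp_curve (x, m) t = (t *\<^sub>R x, mat_exp (t *\<^sub>R m))"
  by (simp add: exp_curve_def)

text \<open>The vector parts \<open>t *\<^sub>R x\<close> of the exponential curves contribute one
  explicit factor \<open>t\<close>, so \<open>F\<close> is divided by \<open>t ^ k\<close> only,
  whereas the logarithm of the group part is divided by \<open>t ^ Suc k\<close>.\<close>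

lemma has_coord_limitI:
  assumes ev: "\<forall>\<^sub>F t in at 0. g t = (t *\<^sub>R F t, mat_exp (D (w t)))"
    and F: "((\<lambda>t. (1 / t ^ k) *\<^sub>R F t) \<longlongrightarrow> x) (at 0)"
    and w: "(w \<longlongrightarrow> 0) (at 0)" "((\<lambda>t. (1 / t ^ Suc k) *\<^sub>R w t) \<longlongrightarrow> w0) (at 0)"
  shows "has_coord_limit (range D) (Suc k) g (x, D w0)"
  unfolding has_coord_limit_def
proof (intro exI conjI)
  let ?c = "\<lambda>t. (t *\<^sub>R F t, D (w t))"
  show "\<forall>\<^sub>F t in at 0. snd (?c t) \<in> range D \<and> g t = (fst (?c t), mat_exp (snd (?c t)))"
    using ev by eventually_elim simp
  have F': "((\<lambda>t. (1 / t ^ Suc k) *\<^sub>R (t *\<^sub>R F t)) \<longlongrightarrow> x) (at 0)"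
    by (rule Lim_transform_eventually[OF F]) (auto simp: eventually_at intro!: exI[of _ 1])
  have Dw: "((\<lambda>t. (1 / t ^ Suc k) *\<^sub>R D (w t)) \<longlongrightarrow> D w0) (at 0)"
    using bounded_linear.tendsto[OF bounded_linear_D w(2)] by (simp add: linear_simps[OF bounded_linear_D])
  show "((\<lambda>t. (1 / t ^ Suc k) *\<^sub>R ?c t) \<longlongrightarrow> (x, D w0)) (at 0)"
    unfolding scaleR_Pair by (rule tendsto_Pair[OF F' Dw])
  show "(?c \<longlongrightarrow> 0) (at 0)"
    unfolding zero_prod_def
    by (rule tendsto_Pair[OF tendsto_0_if_scaled[OF F'] tendsto_0_if_scaled[OF Dw]]) simp_all
qed

text \<open>The differential of \<open>\<delta>\<close> on the Lie algebra; \<open>D\<close> is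
  injective, so the coordinate of an element of \<open>range D\<close> is well defined.\<close>

definition "d m = D' (inv_into UNIV D m)"

lemma d_D: "d (D w) = D' w"
  by (simp add: d_def inv_f_f[OF inj_D])

definition "q m = m + R ** (d m ** B - B ** m)"

definition "K a b = R ** (A ** b - d b ** A) ** R ** (d a ** B - B ** a)"

text \<open>The group part \<open>?C\<close> has zero velocity, so by \<open>tangent_Q\<close> the
  terms \<open>Q (?C t) (?Y t ** ?X t)\<close> are \<open>mat 1\<close> up to \<open>o(t)\<close>.
  The vector part is thus governed by the derivatives \<open>q (D w1)\<close> and
  \<open>q (D w2)\<close>, the group part by \<open>commutator_curve_log\<close>.\<close>

lemma bracket_limit:
  "has_coord_limit (range D) 2 (commutator_curve (UNIV \<times> \<Gamma>) (xi_mult A B \<delta>) (x1, D w1) (x2, D w2))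
    (q (D w1) *v x2 - q (D w2) *v x1, commutator (D w1) (D w2))"
proof -
  let ?X = "\<lambda>t. mat_exp (t *\<^sub>R D w1)" and ?Y = "\<lambda>t. mat_exp (t *\<^sub>R D w2)"
  let ?C = "\<lambda>t. ?X t ** ?Y t ** matrix_inv (?Y t ** ?X t)"
  let ?F = "\<lambda>t. (Q (?X t) (?Y t) - Q (?C t) (?Y t ** ?X t)) *v x2
      - (Q (?C t) (?Y t ** ?X t) ** Q (?Y t) (?X t) - mat 1) *v x1"
  have X: "curve ?X (D w1) (D' w1)" and Y: "curve ?Y (D w2) (D' w2)" by (rule curve_exp)+
  have C: "curve ?C 0 0"
    using curve_mult[OF curve_mult[OF X Y] curve_inv[OF curve_mult[OF Y X]]] by simp
  obtain w w0 where w: "\<forall>\<^sub>F t in at 0. ?C t = mat_exp (D (w t))" "D w0 = commutator (D w1) (D w2)"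
    "(w \<longlongrightarrow> 0) (at 0)" "((\<lambda>t. (1 / t ^ 2) *\<^sub>R w t) \<longlongrightarrow> w0) (at 0)"
    by (rule commutator_curve_log)
  have "has_coord_limit (range D) (Suc 1) (commutator_curve (UNIV \<times> \<Gamma>) (xi_mult A B \<delta>) (x1, D w1) (x2, D w2))
      (q (D w1) *v x2 - q (D w2) *v x1, D w0)"
  proof (rule has_coord_limitI[where F = ?F and w = w])
    show "\<forall>\<^sub>F t in at 0. commutator_curve (UNIV \<times> \<Gamma>) (xi_mult A B \<delta>) (x1, D w1) (x2, D w2) t
        = (t *\<^sub>R ?F t, mat_exp (D (w t)))"
      using curve_in[OF X] curve_in[OF Y] w(1)
    proof eventually_elim
      case (elim t)
      show ?case
        unfolding elim(3)[symmetric]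
        using elim(1,2)
        by (simp add: commutator_curve_def exp_curve_eq xi_mult_eq right_div_eq mult_in Let_def
            matrix_vector_mult_diff_rdistrib matrix_vector_right_distrib matrix_vector_mult_scaleR
            matrix_vector_mul_assoc scaleR_diff_right scaleR_add_right)
    qed
    have "tangent (\<lambda>t. Q (?X t) (?Y t) - Q (?C t) (?Y t ** ?X t)) 0 (q (D w1))"
      using tangent_diff[OF tangent_Q[OF X Y] tangent_Q[OF C curve_mult[OF Y X]]] by (simp add: q_def d_D)
    then have 1: "((\<lambda>t. (1 / t) *\<^sub>R (Q (?X t) (?Y t) - Q (?C t) (?Y t ** ?X t))) \<longlongrightarrow> q (D w1)) (at 0)"
      by (simp add: tangent_def)
    have "tangent (\<lambda>t. Q (?C t) (?Y t ** ?X t) ** Q (?Y t) (?X t)) (mat 1) (q (D w2))"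
      using tangent_mult[OF tangent_Q[OF C curve_mult[OF Y X]] tangent_Q[OF Y X]] by (simp add: q_def d_D)
    then have 2: "((\<lambda>t. (1 / t) *\<^sub>R (Q (?C t) (?Y t ** ?X t) ** Q (?Y t) (?X t) - mat 1)) \<longlongrightarrow> q (D w2)) (at 0)"
      by (simp add: tangent_def)
    from tendsto_diff[OF bounded_linear.tendsto[OF bounded_linear_matrix_vector_left 1]
        bounded_linear.tendsto[OF bounded_linear_matrix_vector_left 2]]
    show "((\<lambda>t. (1 / t ^ 1) *\<^sub>R ?F t) \<longlongrightarrow> q (D w1) *v x2 - q (D w2) *v x1) (at 0)"
      by (simp add: scaleR_matrix_vector_assoc[symmetric] scaleR_diff_right[symmetric])
  qed (use w in \<open>simp_all add: numeral_2_eq_2\<close>)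
  then show ?thesis by (simp add: w(2) numeral_2_eq_2)
qed

text \<open>Associativity of the matrix product makes the group part \<open>mat 1\<close>, and
  \<open>Q_cocycle\<close> removes the third vector. By \<open>Q_eq\<close> the coefficient of the
  second vector is a product of two factors of order \<open>t\<close>, whose limits multiply to
  \<open>K\<close>.\<close>

lemma associator_limit:
  "has_coord_limit (range D) 3 (associator_curve (UNIV \<times> \<Gamma>) (xi_mult A B \<delta>) (x1, D w1) (x2, D w2) (x3, D w3))
    (K (D w1) (D w3) *v x2, 0)"
proof -
  let ?X = "\<lambda>t. mat_exp (t *\<^sub>R D w1)" and ?Y = "\<lambda>t. mat_exp (t *\<^sub>R D w2)" and ?Z = "\<lambda>t. mat_exp (t *\<^sub>R D w3)"
  let ?F = "\<lambda>t. (Q (?X t) (?Y t) - Q (?X t) (?Y t ** ?Z t)) *v x2"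
  have X: "curve ?X (D w1) (D' w1)" and Y: "curve ?Y (D w2) (D' w2)" and Z: "curve ?Z (D w3) (D' w3)"
    by (rule curve_exp)+
  have "has_coord_limit (range D) (Suc 2) (associator_curve (UNIV \<times> \<Gamma>) (xi_mult A B \<delta>) (x1, D w1) (x2, D w2) (x3, D w3))
      (K (D w1) (D w3) *v x2, D 0)"
  proof (rule has_coord_limitI[where F = ?F and w = "\<lambda>t. 0"])
    show "\<forall>\<^sub>F t in at 0. associator_curve (UNIV \<times> \<Gamma>) (xi_mult A B \<delta>) (x1, D w1) (x2, D w2) (x3, D w3) t
        = (t *\<^sub>R ?F t, mat_exp (D 0))"
      using curve_in[OF X] curve_in[OF Y] curve_in[OF Z]
    proof eventually_elim
      case (elim t)
      have "?X t ** ?Y t ** ?Z t ** matrix_inv (?X t ** ?Y t ** ?Z t) = mat 1"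
        using elim by (intro matrix_inv_mult invertible_\<Gamma> mult_in)
      then show ?case
        using elim Q_cocycle[OF elim]
        by (simp add: associator_curve_def exp_curve_eq xi_mult_eq right_div_eq mult_in Let_def Q_one D_0
            matrix_vector_mult_diff_rdistrib matrix_vector_right_distrib matrix_vector_mult_scaleR
            matrix_vector_mul_assoc matrix_mul_assoc scaleR_diff_right scaleR_add_right)
    qed
    \<comment> \<open>The velocities of \<open>?X\<close> and \<open>?Y\<close> cancel in this
      difference and only that of \<open>?Z\<close> survives.\<close>
    have "tangent (\<lambda>t. matrix_inv (P (?X t ** ?Y t)) - matrix_inv (P (?X t ** (?Y t ** ?Z t)))) 0
        (R ** (A ** D w3 - D' w3 ** A) ** R)"
      using tangent_diff[OF tangent_inv_P[OF curve_mult[OF X Y]] tangent_inv_P[OF curve_mult[OF X curve_mult[OF Y Z]]]]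
      by (simp add: matrix_ring_simps)
    then have 1: "((\<lambda>t. (1 / t) *\<^sub>R (matrix_inv (P (?X t ** ?Y t)) - matrix_inv (P (?X t ** (?Y t ** ?Z t)))))
        \<longlongrightarrow> R ** (A ** D w3 - D' w3 ** A) ** R) (at 0)"
      by (simp add: tangent_def)
    have 2: "((\<lambda>t. (1 / t) *\<^sub>R (\<delta> (?X t) ** B - B ** ?X t)) \<longlongrightarrow> D' w1 ** B - B ** D w1) (at 0)"
      using tangent_\<delta>_defect[OF X] by (simp add: tangent_def)
    from bounded_linear.tendsto[OF bounded_linear_matrix_vector_left mm.tendsto[OF 1 2], of x2]
    show "((\<lambda>t. (1 / t ^ 2) *\<^sub>R ?F t) \<longlongrightarrow> K (D w1) (D w3) *v x2) (at 0)"
      unfolding K_def d_D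
    proof (rule Lim_transform_eventually)
      show "\<forall>\<^sub>F t in at 0. ((1 / t) *\<^sub>R (matrix_inv (P (?X t ** ?Y t)) - matrix_inv (P (?X t ** (?Y t ** ?Z t))))
          ** ((1 / t) *\<^sub>R (\<delta> (?X t) ** B - B ** ?X t))) *v x2 = (1 / t ^ 2) *\<^sub>R ?F t"
        using curve_in[OF X] curve_in[OF Y] curve_in[OF Z]
      proof eventually_elim
        case (elim t)
        have "Q (?X t) (?Y t) - Q (?X t) (?Y t ** ?Z t)
            = (matrix_inv (P (?X t ** ?Y t)) - matrix_inv (P (?X t ** (?Y t ** ?Z t)))) ** (\<delta> (?X t) ** B - B ** ?X t)"
          using elim by (simp add: Q_eq mult_in mm.diff_left)
        then show ?case
          by (simp add: mm.scaleR_left mm.scaleR_right scaleR_matrix_vector_assoc[symmetric] power2_eq_square)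
      qed
    qed
  qed simp_all
  then show ?thesis by (simp add: D_0 numeral_3_eq_3 numeral_2_eq_2)
qed

end

section \<open>The algebra behind the semidirect product\<close>

lemma commutator_jacobi:
  "commutator (commutator a b) c + commutator (commutator c a) b + commutator (commutator b c) a = 0"
  by (simp add: commutator_def matrix_ring_simps)

text \<open>This computes the failure of \<open>q\<close> to respect commutators as the
  antisymmetrization of \<open>K\<close>, which is what the Akivis identity requires of the vector
  component. With \<open>A = B - S\<close>, where \<open>S\<close> is inverse to \<open>R\<close>,
  both sides expand to the same words after cancellation.\<close>

lemma commutator_expansion:
  fixes A B R a b a' b' :: "real^'n^'n"
  assumes "R ** (B - A) = mat 1" "(B - A) ** R = mat 1"
  shows "commutator a b + R ** (commutator a' b' ** B - B ** commutator a b)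
    = (a + R ** (a' ** B - B ** a)) ** (b + R ** (b' ** B - B ** b))
      - (b + R ** (b' ** B - B ** b)) ** (a + R ** (a' ** B - B ** a))
      + R ** (A ** a - a' ** A) ** R ** (b' ** B - B ** b)
      - R ** (A ** b - b' ** A) ** R ** (a' ** B - B ** a)"
proof -
  define S where "S = B - A"
  have A: "A = B - S" by (simp add: S_def)
  have RS: "R ** S = mat 1" "S ** R = mat 1"
    using assms by (simp_all add: S_def)
  \<comment> \<open>Products are kept associated to the left, so the cancellation is also needed
    behind a prefix \<open>X\<close>.\<close>
  have RS': "X ** R ** S = X" "X ** S ** R = X" for X
    using RS by (simp_all flip: matrix_mul_assoc)
  show ?thesis
    unfolding A commutator_def by (simp add: matrix_ring_simps RS RS' algebra_simps)
qed

text \<open>Separates the algebra from the limits. The vector component of the Akivis identity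
  follows from \<open>qK\<close>, the matrix component from the Jacobi identity. The homomorphism
  sends \<open>(x, a)\<close> to \<open>(0, a)\<close>. The associator vanishes on the vectors
  because \<open>K\<close> vanishes at \<open>0\<close>, and on the Lie algebra because the middle
  vector is \<open>0\<close>.\<close>

lemma akivis_semidirect_productI:
  fixes \<mm> :: "(real^'n^'n) set"
    and q :: "real^'n^'n \<Rightarrow> real^'n^'n"
    and K :: "real^'n^'n \<Rightarrow> real^'n^'n \<Rightarrow> real^'n^'n"
    and br :: "(real^'n) \<times> (real^'n^'n) \<Rightarrow> (real^'n) \<times> (real^'n^'n) \<Rightarrow> (real^'n) \<times> (real^'n^'n)"
  assumes \<mm>: "subspace \<mm>" "\<And>a b. a \<in> \<mm> \<Longrightarrow> b \<in> \<mm> \<Longrightarrow> commutator a b \<in> \<mm>"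
    and q: "\<And>a b. a \<in> \<mm> \<Longrightarrow> b \<in> \<mm> \<Longrightarrow> q (a + b) = q a + q b"
      "\<And>c a. a \<in> \<mm> \<Longrightarrow> q (c *\<^sub>R a) = c *\<^sub>R q a"
    and K: "\<And>a a' b. a \<in> \<mm> \<Longrightarrow> a' \<in> \<mm> \<Longrightarrow> b \<in> \<mm> \<Longrightarrow> K (a + a') b = K a b + K a' b"
      "\<And>a b b'. a \<in> \<mm> \<Longrightarrow> b \<in> \<mm> \<Longrightarrow> b' \<in> \<mm> \<Longrightarrow> K a (b + b') = K a b + K a b'"
      "\<And>c a b. a \<in> \<mm> \<Longrightarrow> b \<in> \<mm> \<Longrightarrow> K (c *\<^sub>R a) b = c *\<^sub>R K a b"
      "\<And>c a b. a \<in> \<mm> \<Longrightarrow> b \<in> \<mm> \<Longrightarrow> K a (c *\<^sub>R b) = c *\<^sub>R K a b"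
    and qK: "\<And>a b. a \<in> \<mm> \<Longrightarrow> b \<in> \<mm> \<Longrightarrow> q (commutator a b) = q a ** q b - q b ** q a + K b a - K a b"
    and br: "\<And>x a y b. a \<in> \<mm> \<Longrightarrow> b \<in> \<mm> \<Longrightarrow> br (x, a) (y, b) = (q a *v y - q b *v x, commutator a b)"
    and as: "\<And>x a y b z c. a \<in> \<mm> \<Longrightarrow> b \<in> \<mm> \<Longrightarrow> c \<in> \<mm> \<Longrightarrow> as (x, a) (y, b) (z, c) = (K a c *v y, 0)"
  shows "akivis_semidirect_product (UNIV \<times> \<mm>) br as (UNIV \<times> {0}) ({0} \<times> \<mm>)"
proof -
  note mv = matrix_vector_mult_add_rdistrib matrix_vector_right_distrib matrix_vector_mult_diff_rdistrib
    matrix_vector_mult_scaleR scaleR_matrix_vector_assoc[symmetric]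
  have in\<mm> [simp]: "0 \<in> \<mm>" "\<And>a b. a \<in> \<mm> \<Longrightarrow> b \<in> \<mm> \<Longrightarrow> a + b \<in> \<mm>" "\<And>c a. a \<in> \<mm> \<Longrightarrow> c *\<^sub>R a \<in> \<mm>"
    using \<mm>(1) by (simp_all add: subspace_0 subspace_add subspace_scale)
  have q0: "q 0 = 0" using q(2)[OF in\<mm>(1), of 0] by simp
  have K0: "K a 0 = 0" "K 0 a = 0" if "a \<in> \<mm>" for a
    using K(4)[OF that in\<mm>(1), of 0] K(3)[OF in\<mm>(1) that, of 0] by simp_all
  have sub: "subspace (UNIV \<times> \<mm>)" "subspace (UNIV \<times> {0 :: real^'n^'n})" "subspace ({0 :: real^'n} \<times> \<mm>)"
    using \<mm>(1) by (auto simp: subspace_def zero_prod_def)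
  have akivis: "br (br x y) z + br (br z x) y + br (br y z) x
      = as x y z + as y z x + as z x y - as z y x - as x z y - as y x z"
    if xyz: "x \<in> UNIV \<times> \<mm>" "y \<in> UNIV \<times> \<mm>" "z \<in> UNIV \<times> \<mm>" for x y z
  proof -
    obtain u a where x [simp]: "x = (u, a)" "a \<in> \<mm>" using xyz(1) by auto
    obtain v b where y [simp]: "y = (v, b)" "b \<in> \<mm>" using xyz(2) by auto
    obtain w c where z [simp]: "z = (w, c)" "c \<in> \<mm>" using xyz(3) by auto
    show ?thesis
      using commutator_jacobi[of a b c]
      by (simp add: br as \<mm>(2) qK mv matrix_vector_mul_assoc algebra_simps)
  qed
  have "akivis_algebra (UNIV \<times> \<mm>) br as"
    unfolding akivis_algebra_def
  proof (intro conjI)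
    show "\<forall>x\<in>UNIV \<times> \<mm>. linear_map_on (UNIV \<times> \<mm>) (\<lambda>y. br x y) \<and> linear_map_on (UNIV \<times> \<mm>) (\<lambda>y. br y x)"
      by (auto simp: linear_map_on_def br q mv commutator_def matrix_ring_simps algebra_simps)
    show "\<forall>x\<in>UNIV \<times> \<mm>. \<forall>y\<in>UNIV \<times> \<mm>. linear_map_on (UNIV \<times> \<mm>) (\<lambda>z. as z x y) \<and>
        linear_map_on (UNIV \<times> \<mm>) (\<lambda>z. as x z y) \<and> linear_map_on (UNIV \<times> \<mm>) (\<lambda>z. as x y z)"
      by (auto simp: linear_map_on_def as K mv)
    show "\<forall>x\<in>UNIV \<times> \<mm>. \<forall>y\<in>UNIV \<times> \<mm>. br x y = - br y x"
      by (auto simp: br commutator_def)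
  qed (use sub akivis in \<open>auto simp: br as \<mm>(2)\<close>)
  moreover have "lie_subalgebra br as (UNIV \<times> \<mm>) (UNIV \<times> {0})"
    unfolding lie_subalgebra_def using sub by (auto simp: br as q0 K0 commutator_def zero_prod_def)
  moreover have "lie_subalgebra br as (UNIV \<times> \<mm>) ({0} \<times> \<mm>)"
    unfolding lie_subalgebra_def using sub by (auto simp: br as \<mm>(2) commutator_jacobi zero_prod_def)
  moreover have "akivis_hom_into br as (UNIV \<times> \<mm>) ({0} \<times> \<mm>) (\<lambda>x. (0, snd x))"
    unfolding akivis_hom_into_def linear_map_on_def by (auto simp: br as)
  ultimately show ?thesis
    unfolding akivis_semidirect_product_def
    by (auto simp: zero_prod_def intro!: exI[of _ "\<lambda>x. (0, snd x)"])
qed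

section \<open>Application to the loop\<close>

context xi_loop
begin

lemma subspace_range_D: "subspace (range D)"
  using bounded_linear.linear[OF bounded_linear_D] by (intro linear_subspace_image subspace_UNIV)

lemma commutator_in:
  assumes "a \<in> range D" "b \<in> range D"
  shows "commutator a b \<in> range D" "d (commutator a b) = commutator (d a) (d b)"
proof -
  from assms obtain w1 w2 where ab: "a = D w1" "b = D w2" by auto
  obtain w0 where w0: "D w0 = commutator a b"
    unfolding ab by (rule commutator_curve_log)
  then show "commutator a b \<in> range D" by (metis rangeI)
  show "d (commutator a b) = commutator (d a) (d b)"
    using D'_commutator[of w0 w1 w2] w0 unfolding ab by (metis d_D)
qed

lemma d_linear:
  "a \<in> range D \<Longrightarrow> b \<in> range D \<Longrightarrow> d (a + b) = d a + d b"
  "a \<in> range D \<Longrightarrow> d (c *\<^sub>R a) = c *\<^sub>R d a"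
  by (auto simp: d_D linear_simps[OF bounded_linear_D'] simp flip: linear_simps[OF bounded_linear_D])

lemma q_commutator:
  assumes "a \<in> range D" "b \<in> range D"
  shows "q (commutator a b) = q a ** q b - q b ** q a + K b a - K a b"
  unfolding q_def K_def commutator_in(2)[OF assms] by (rule commutator_expansion[OF R_mult])

lemma q_linear:
  "a \<in> range D \<Longrightarrow> b \<in> range D \<Longrightarrow> q (a + b) = q a + q b"
  "a \<in> range D \<Longrightarrow> q (c *\<^sub>R a) = c *\<^sub>R q a"
  by (simp_all add: q_def d_linear matrix_ring_simps algebra_simps)

lemma K_linear:
  "a \<in> range D \<Longrightarrow> a' \<in> range D \<Longrightarrow> K (a + a') b = K a b + K a' b"
  "b \<in> range D \<Longrightarrow> b' \<in> range D \<Longrightarrow> K a (b + b') = K a b + K a b'"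
  "a \<in> range D \<Longrightarrow> K (c *\<^sub>R a) b = c *\<^sub>R K a b"
  "b \<in> range D \<Longrightarrow> K a (c *\<^sub>R b) = c *\<^sub>R K a b"
  by (simp_all add: K_def d_linear matrix_ring_simps algebra_simps)

lemma loop_bracket_eq:
  assumes "a \<in> range D" "b \<in> range D"
  shows "loop_bracket (UNIV \<times> \<Gamma>) (xi_mult A B \<delta>) (range D) (x, a) (y, b)
      = (q a *v y - q b *v x, commutator a b)"
  using assms bracket_limit has_coord_limit_unique unfolding loop_bracket_def by blast

lemma loop_associator_eq:
  assumes "a \<in> range D" "b \<in> range D" "c \<in> range D"
  shows "loop_associator (UNIV \<times> \<Gamma>) (xi_mult A B \<delta>) (range D) (x, a) (y, b) (z, c) = (K a c *v y, 0)"
  using assms associator_limit has_coord_limit_unique unfolding loop_associator_def by blast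

lemma akivis_semidirect:
  "akivis_semidirect_product (UNIV \<times> range D)
    (loop_bracket (UNIV \<times> \<Gamma>) (xi_mult A B \<delta>) (range D))
    (loop_associator (UNIV \<times> \<Gamma>) (xi_mult A B \<delta>) (range D)) (UNIV \<times> {0}) ({0} \<times> range D)"
  by (rule akivis_semidirect_productI[where q = q and K = K])
    (simp_all add: subspace_range_D commutator_in(1) q_commutator loop_bracket_eq loop_associator_eq
      q_linear K_linear)

lemma q_0: "q 0 = 0"
  using d_D[of 0] by (simp add: q_def D_0 linear_simps[OF bounded_linear_D'])

end

text \<open>The first two conjuncts ensure that the limits exist, so that the \<open>THE\<close> in
  the two operations denotes them. The last two identify the summands as Lie algebras: the vectors
  with the commutative one and the complement with that of the group.\<close>

theorem proposition5:
  fixes \<Gamma> :: "(real^'n^'n) set"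
    and T :: "(real^'n^'n) topology"
    and \<A> :: "(real^'n^'n, 'k::euclidean_space) atlas"
    and \<delta> :: "real^'n^'n \<Rightarrow> real^'n^'n"
    and A B :: "real^'n^'n"
  assumes "lie_subgroup \<Gamma> T \<A>"
    and "\<delta> \<in> hom (GL\<lparr>carrier := \<Gamma>\<rparr>) (GL\<lparr>carrier := \<Gamma>\<rparr>)"
    and "A \<in> carrier GL" and "B \<in> carrier GL"
    and "\<And>M. M \<in> \<Gamma> \<Longrightarrow> \<not> mat_eigenvalue (matrix_inv M ** matrix_inv B ** \<delta> M ** A) 1"
    and "smooth_loop (prod_topology euclidean T) (prod_atlas euclidean_atlas \<A>)
           (xi_mult A B \<delta>) (0, mat 1)"
  shows "let L = UNIV \<times> \<Gamma>; f = xi_mult A B \<delta>;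
             \<mm> = lie_algebra_of \<A>; \<aa> = UNIV \<times> \<mm>;
             br = loop_bracket L f \<mm>; as = loop_associator L f \<mm>;
             N = UNIV \<times> {0}; M = {0} \<times> \<mm>
         in (\<forall>v1\<in>\<aa>. \<forall>v2\<in>\<aa>. has_coord_limit \<mm> 2 (commutator_curve L f v1 v2) (br v1 v2)) \<and>
            (\<forall>v1\<in>\<aa>. \<forall>v2\<in>\<aa>. \<forall>v3\<in>\<aa>.
               has_coord_limit \<mm> 3 (associator_curve L f v1 v2 v3) (as v1 v2 v3)) \<and>
            akivis_semidirect_product \<aa> br as N M \<and>
            (\<forall>x y. br (x, 0) (y, 0) = 0) \<and>
            (\<forall>m1\<in>\<mm>. \<forall>m2\<in>\<mm>. br (0, m1) (0, m2) = (0, commutator m1 m2))"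
proof -
  have "mat 1 \<in> \<Gamma>" "topspace T = \<Gamma>" "smooth_manifold T \<A>"
    using assms(1) subgroup.one_closed[of \<Gamma> GL] by (auto simp: lie_subgroup_def GL_def)
  \<comment> \<open>The chart domains cover \<open>\<Gamma>\<close>, so one of them contains the
    identity.\<close>
  then obtain U \<phi> where "(U, \<phi>) \<in> \<A>" "mat 1 \<in> U"
    unfolding smooth_manifold_def by auto
  then interpret xi_loop \<Gamma> T \<A> U \<phi> \<delta> A B
    using assms by (intro xi_loop.intro lie_chart.intro xi_loop_axioms.intro)
  have 0: "0 \<in> range D" using subspace_range_D by (rule subspace_0)
  have "\<forall>v1\<in>UNIV \<times> range D. \<forall>v2\<in>UNIV \<times> range D.
      has_coord_limit (range D) 2 (commutator_curve (UNIV \<times> \<Gamma>) (xi_mult A B \<delta>) v1 v2)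
        (loop_bracket (UNIV \<times> \<Gamma>) (xi_mult A B \<delta>) (range D) v1 v2)"
    by (auto simp: loop_bracket_eq bracket_limit)
  moreover have "\<forall>v1\<in>UNIV \<times> range D. \<forall>v2\<in>UNIV \<times> range D. \<forall>v3\<in>UNIV \<times> range D.
      has_coord_limit (range D) 3 (associator_curve (UNIV \<times> \<Gamma>) (xi_mult A B \<delta>) v1 v2 v3)
        (loop_associator (UNIV \<times> \<Gamma>) (xi_mult A B \<delta>) (range D) v1 v2 v3)"
    by (auto simp: loop_associator_eq associator_limit)
  moreover have "\<forall>x y. loop_bracket (UNIV \<times> \<Gamma>) (xi_mult A B \<delta>) (range D) (x, 0) (y, 0) = 0"
    by (simp add: loop_bracket_eq 0 q_0 commutator_def zero_prod_def)
  moreover have "\<forall>m1\<in>range D. \<forall>m2\<in>range D.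
      loop_bracket (UNIV \<times> \<Gamma>) (xi_mult A B \<delta>) (range D) (0, m1) (0, m2) = (0, commutator m1 m2)"
    by (simp add: loop_bracket_eq)
  ultimately show ?thesis
    unfolding Let_def lie_algebra_eq using akivis_semidirect by blast
qed

end
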